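(* Let $M\ge 2$ be an integer and assume that the space $\mathcal{X}$ is infinite. For $h\ge 0$ let $\phi_h:\mathbb{R}\to\mathbb{R}$ be the loss function $$\phi_h(x)=\begin{cases} h\max(0,1-x)+(1-h)\mathbf{1}_{(x\le 0)} & \text{if } 0\le h\le 1,\\ (h-1)x^2-x+1 & \text{if } h>1.\end{cases}$$ Then the following hold (optimal rate of aggregation, optimal aggregation procedure, and the ERM, AEW and CAEW procedures are defined in the context). (1) If $0\le h<1$, the optimal rate of aggregation for the $\phi_h$-risk is achieved by the ERM procedure and is equal to $\sqrt{\frac{\log M}{n}}$. (2) If $h=1$, the optimal rate of aggregation for the $\phi_1$-risk is achieved by the ERM procedure, by the AEW procedure, and by the CAEW procedure with temperature parameter $\beta=1$, and is equal to $\sqrt{\frac{\log M}{n}}$. (3) If $h>1$, the optimal rate of aggregation for the $\phi_h$-risk is achieved by the CAEW procedure with temperature parameter $\beta_h=\frac{(2h-1)^2}{2(h-1)}$ and is equal to $\frac{\log M}{n}$.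
   Context: **Setting.** $(\mathcal{X},\mathcal{A})$ is a measurable space and $(X,Y)$ is a random pair with $X\in\mathcal{X}$, $Y\in\{-1,1\}$, and distribution $\pi$ on $\mathcal{X}\times\{-1,1\}$. We observe a sample $D_n$ of $n$ i.i.d. copies $(X_1,Y_1),\dots,(X_n,Y_n)$ of $(X,Y)$. A statistic (estimator) $\bar f_n$ is a real-valued function on $\mathcal{X}$ constructed from $D_n$. Expectations $\mathbb{E}[A^\phi(\bar f_n)-A^\phi_*]$ are over $D_n$. **Risk.** For a loss function $\phi:\mathbb{R}\to\mathbb{R}$ and $f:\mathcal{X}\to\mathbb{R}$, the $\phi$-risk is $A^\phi(f)=\mathbb{E}[\phi(Yf(X))]$ (for a data-dependent $f$, the expectation here is over $(X,Y)$ independent of the data). The minimal risk is $A^\phi_*=\min_f A^\phi(f)$, the minimum being over all real-valued functions $f$ on $\mathcal{X}$. The empirical $\phi$-risk is $A^\phi_n(f)=\frac1n\sum_{i=1}^n\phi(Y_if(X_i))$. **Optimal rate of aggregation.** The remainder term $\gamma(n,M)$ is called an optimal rate of aggregation for the $\phi$-risk if the following two properties hold, where $C_1,C_2$ are absolute positive constants which may depend on $\phi$: i) For any finite set $\mathcal{F}$ of $M$ functions from $\mathcal{X}$ to $[-1,1]$ there exists a statistic $\tilde f_n$ such that for any underlying probability measure $\pi$ and any integer $n\ge1$, $$\mathbb{E}[A^\phi(\tilde f_n)-A^\phi_*]\le \min_{f\in\mathcal{F}}\big(A^\phi(f)-A^\phi_*\big)+C_1\gamma(n,M).$$ ii) There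 exists a finite set $\mathcal{F}$ of $M$ functions from $\mathcal{X}$ to $[-1,1]$ such that for any statistic $\bar f_n$ there exists a probability distribution $\pi$ such that for all $n\ge 1$ $$\mathbb{E}[A^\phi(\bar f_n)-A^\phi_*]\ge \min_{f\in\mathcal{F}}\big(A^\phi(f)-A^\phi_*\big)+C_2\gamma(n,M).$$ When i) and ii) hold, the procedure $\tilde f_n$ in i) is called an optimal aggregation procedure for the $\phi$-risk, and one says that the optimal rate is achieved by $\tilde f_n$. **Procedures**, for a finite set $\mathcal{F}$ of functions $\mathcal{X}\to[-1,1]$ and a loss $\phi$: - ERM (Empirical Risk Minimization): any $\tilde f_n^{ERM}\in\operatorname{Argmin}_{f\in\mathcal{F}}A_n^\phi(f)$. - AEW (Aggregation with Exponential Weights): $\tilde f_n^{AEW}=\sum_{f\in\mathcal{F}}w^{(n)}(f)f$ with $w^{(n)}(f)=\dfrac{\exp(-nA_n^\phi(f))}{\sum_{g\in\mathcal{F}}\exp(-nA_n^\phi(g))}$. - CAEW (Cumulative Aggregation with Exponential Weights) with temperature parameter $\beta>0$: $\tilde f_{n,\beta}^{CAEW}=\frac1n\sum_{k=1}^n\tilde f_{k,\beta}^{AEW}$, where $\tilde f_{k,\beta}^{AEW}=\sum_{f\in\mathcal{F}}w_\beta^{(k)}(f)f$, $w_\beta^{(k)}(f)=\dfrac{\exp(-\beta^{-1}kA_k^\phi(f))}{\sum_{g\in\mathcal{F}}\exp(-\beta^{-1}kA_k^\phi(g))}$, and $A_k^\phi$ is the empirical $\phi$-risk based on $(X_1,Y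_1),\dots,(X_k,Y_k)$.
   Formalization: In (ii), π may depend on n and the lower bound is C₂·min(1, γ(n,M)); besides 𝒳 infinite, its σ-algebra is assumed infinite: the literal forms fail. C₁, C₂ depend only on h, uniformly over spaces whose points lie in one given set. *)

theory Defs
  imports "HOL-Probability.Probability"
begin

text \<open>Expectation \<open>E[Z\<^sup>+] - E[Z\<^sup>-]\<close> with extended real values. The Bochner integral is not used
  because it is 0 for non-integrable functions, whereas the risk of an unbounded function can be
  \<open>\<infinity>\<close>.\<close>

definition ext_expectation :: "'b measure \<Rightarrow> ('b \<Rightarrow> ereal) \<Rightarrow> ereal" where
  "ext_expectation P Z =
     enn2ereal (\<integral>\<^sup>+ w. e2ennreal (Z w) \<partial>P) - enn2ereal (\<integral>\<^sup>+ w. e2ennreal (- Z w) \<partial>P)"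

text \<open>A measurable space is represented by a measure \<open>X\<close> of which only \<open>space X\<close> and \<open>sets X\<close>
  are used.\<close>

definition obs_space :: "'a measure \<Rightarrow> ('a \<times> real) measure" where
  "obs_space X = X \<Otimes>\<^sub>M count_space {-1, 1}"

definition pair_distributions :: "'a measure \<Rightarrow> ('a \<times> real) measure set" where
  "pair_distributions X = {\<pi>. prob_space \<pi> \<and> sets \<pi> = sets (obs_space X)}"

definition risk :: "(real \<Rightarrow> real) \<Rightarrow> ('a \<times> real) measure \<Rightarrow> ('a \<Rightarrow> real) \<Rightarrow> ereal" where
  "risk \<phi> \<pi> f = ext_expectation \<pi> (\<lambda>(x, y). ereal (\<phi> (y * f x)))"

definition min_risk :: "(real \<Rightarrow> real) \<Rightarrow> 'a measure \<Rightarrow> ('a \<times> real) measure \<Rightarrow> ereal" where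
  "min_risk \<phi> X \<pi> = (INF f\<in>borel_measurable X. risk \<phi> \<pi> f)"

definition excess_risk ::
  "(real \<Rightarrow> real) \<Rightarrow> 'a measure \<Rightarrow> ('a \<times> real) measure \<Rightarrow> ('a \<Rightarrow> real) \<Rightarrow> ereal" where
  "excess_risk \<phi> X \<pi> f = risk \<phi> \<pi> f - min_risk \<phi> X \<pi>"

text \<open>An estimator \<open>f\<close> is a sequence: \<open>f n D\<close> is the function built from the sample
  \<open>D = (D 1, \<dots>, D n)\<close>.\<close>

type_synonym 'a estimator = "nat \<Rightarrow> (nat \<Rightarrow> 'a \<times> real) \<Rightarrow> 'a \<Rightarrow> real"

definition sample_space :: "'a measure \<Rightarrow> nat \<Rightarrow> (nat \<Rightarrow> 'a \<times> real) measure" where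
  "sample_space X n = PiM {1..n} (\<lambda>_. obs_space X)"

definition statistic :: "'a measure \<Rightarrow> 'a estimator \<Rightarrow> bool" where
  "statistic X f \<longleftrightarrow>
     (\<forall>n\<ge>1. (\<lambda>(D, x). f n D x) \<in> borel_measurable (sample_space X n \<Otimes>\<^sub>M X))"

definition expected_excess_risk ::
  "(real \<Rightarrow> real) \<Rightarrow> 'a measure \<Rightarrow> ('a \<times> real) measure \<Rightarrow> 'a estimator \<Rightarrow> nat \<Rightarrow> ereal" where
  "expected_excess_risk \<phi> X \<pi> f n =
     ext_expectation (PiM {1..n} (\<lambda>_. \<pi>)) (\<lambda>D. excess_risk \<phi> X \<pi> (f n D))"

text \<open>Functions are taken extensional, so that \<open>M\<close> counts functions that differ on
  \<open>space X\<close>.\<close>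

definition dictionaries :: "'a measure \<Rightarrow> nat \<Rightarrow> ('a \<Rightarrow> real) set set" where
  "dictionaries X M =
     {F. finite F \<and> card F = M \<and> F \<subseteq> (space X \<rightarrow>\<^sub>E {-1..1}) \<inter> borel_measurable X}"

definition emp_risk ::
  "(real \<Rightarrow> real) \<Rightarrow> nat \<Rightarrow> (nat \<Rightarrow> 'a \<times> real) \<Rightarrow> ('a \<Rightarrow> real) \<Rightarrow> real" where
  "emp_risk \<phi> n D f = (1 / real n) * (\<Sum>i=1..n. \<phi> (snd (D i) * f (fst (D i))))"

text \<open>A procedure is a relation between dictionaries and estimators, since the empirical risk
  may have several minimizers.\<close>

type_synonym 'a procedure = "'a measure \<Rightarrow> ('a \<Rightarrow> real) set \<Rightarrow> 'a estimator \<Rightarrow> bool"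

definition ERM :: "(real \<Rightarrow> real) \<Rightarrow> 'a procedure" where
  "ERM \<phi> X F f \<longleftrightarrow>
     (\<forall>n\<ge>1. \<forall>D\<in>space (sample_space X n). is_arg_min (emp_risk \<phi> n D) (\<lambda>g. g \<in> F) (f n D))"

definition exp_weight ::
  "(real \<Rightarrow> real) \<Rightarrow> real \<Rightarrow> ('a \<Rightarrow> real) set \<Rightarrow> nat \<Rightarrow> (nat \<Rightarrow> 'a \<times> real) \<Rightarrow> ('a \<Rightarrow> real) \<Rightarrow> real" where
  "exp_weight \<phi> \<beta> F k D f =
     exp (- (inverse \<beta> * real k * emp_risk \<phi> k D f)) /
     (\<Sum>g\<in>F. exp (- (inverse \<beta> * real k * emp_risk \<phi> k D g)))"

definition exp_aggregate ::
  "(real \<Rightarrow> real) \<Rightarrow> real \<Rightarrow> ('a \<Rightarrow> real) set \<Rightarrow> 'a estimator" where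
  "exp_aggregate \<phi> \<beta> F k D x = (\<Sum>f\<in>F. exp_weight \<phi> \<beta> F k D f * f x)"

definition AEW :: "(real \<Rightarrow> real) \<Rightarrow> 'a procedure" where
  "AEW \<phi> X F f \<longleftrightarrow> f = exp_aggregate \<phi> 1 F"

definition CAEW :: "(real \<Rightarrow> real) \<Rightarrow> real \<Rightarrow> 'a procedure" where
  "CAEW \<phi> \<beta> X F f \<longleftrightarrow>
     f = (\<lambda>n D x. (1 / real n) * (\<Sum>k=1..n. exp_aggregate \<phi> \<beta> F k D x))"

definition upper_bound_by ::
  "'a measure \<Rightarrow> nat \<Rightarrow> (real \<Rightarrow> real) \<Rightarrow> 'a procedure \<Rightarrow> (nat \<Rightarrow> real) \<Rightarrow> bool" where
  "upper_bound_by X M \<phi> proc r \<longleftrightarrow>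
     (\<forall>F\<in>dictionaries X M.
        (\<exists>f. statistic X f \<and> proc X F f) \<and>
        (\<forall>f. statistic X f \<and> proc X F f \<longrightarrow>
           (\<forall>\<pi>\<in>pair_distributions X. \<forall>n\<ge>1.
              expected_excess_risk \<phi> X \<pi> f n \<le> (MIN g\<in>F. excess_risk \<phi> X \<pi> g) + ereal (r n))))"

text \<open>The distribution \<open>\<pi>\<close> may depend on the sample size \<open>n\<close>: for one fixed \<open>\<pi>\<close> the
  expected excess of empirical risk minimization over the best element of \<open>F\<close> is at most
  exponentially small in \<open>n\<close>, so no polynomial lower bound can hold for all \<open>n\<close>. The dictionary
  does not depend on \<open>n\<close>.\<close>

definition lower_bound ::
  "'a measure \<Rightarrow> nat \<Rightarrow> (real \<Rightarrow> real) \<Rightarrow> (nat \<Rightarrow> real) \<Rightarrow> bool" where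
  "lower_bound X M \<phi> r \<longleftrightarrow>
     (\<exists>F\<in>dictionaries X M. \<forall>f. statistic X f \<longrightarrow>
        (\<forall>n\<ge>1. \<exists>\<pi>\<in>pair_distributions X.
           expected_excess_risk \<phi> X \<pi> f n \<ge> (MIN g\<in>F. excess_risk \<phi> X \<pi> g) + ereal (r n)))"

text \<open>The constants are to be chosen independently of \<open>X\<close>, \<open>M\<close> and \<open>n\<close>. For such a constant the
  lower bound has to be truncated where the rate exceeds 1: the estimator 0 has risk \<open>\<phi> 0\<close>, so
  \<open>C\<^sub>2 * \<gamma> n M\<close> cannot be a lower bound when \<open>\<gamma> n M\<close> is large. For fixed \<open>M\<close> the truncation only
  changes the constant; see \<open>optimal_rate_untruncated\<close> below.\<close>

definition optimal_rate_achieved_by ::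
  "real \<Rightarrow> real \<Rightarrow> 'a measure \<Rightarrow> nat \<Rightarrow> (real \<Rightarrow> real) \<Rightarrow> (nat \<Rightarrow> nat \<Rightarrow> real) \<Rightarrow> 'a procedure \<Rightarrow> bool"
  where
  "optimal_rate_achieved_by C\<^sub>1 C\<^sub>2 X M \<phi> \<gamma> proc \<longleftrightarrow>
     upper_bound_by X M \<phi> proc (\<lambda>n. C\<^sub>1 * \<gamma> n M) \<and>
     lower_bound X M \<phi> (\<lambda>n. C\<^sub>2 * min 1 (\<gamma> n M))"

lemma lower_bound_mono:
  assumes "lower_bound X M \<phi> r" and le: "\<And>n. n \<ge> 1 \<Longrightarrow> r' n \<le> r n"
  shows "lower_bound X M \<phi> r'"
proof -
  have "a + ereal (r' n) \<le> b" if "a + ereal (r n) \<le> b" "n \<ge> 1" for a b n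
  proof -
    have "a + ereal (r' n) \<le> a + ereal (r n)" using le[OF that(2)] by (intro add_left_mono) simp
    then show ?thesis using that(1) by (rule order_trans)
  qed
  then show ?thesis
    using assms(1) unfolding lower_bound_def by meson
qed

lemma optimal_rate_untruncated:
  assumes "optimal_rate_achieved_by C\<^sub>1 C\<^sub>2 X M \<phi> \<gamma> proc" and "C\<^sub>2 > 0"
    and anti: "\<And>n. n \<ge> 1 \<Longrightarrow> \<gamma> n M \<le> \<gamma> 1 M" and nonneg: "\<And>n. \<gamma> n M \<ge> 0"
  shows "\<exists>C>0. lower_bound X M \<phi> (\<lambda>n. C * \<gamma> n M)"
proof (intro exI conjI)
  let ?K = "max 1 (\<gamma> 1 M)"
  show "C\<^sub>2 / ?K > 0" using assms(2) by simp
  have "\<gamma> n M / ?K \<le> min 1 (\<gamma> n M)" if "n \<ge> 1" for n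
  proof -
    have "\<gamma> n M \<le> ?K" using anti[OF that] by simp
    moreover have "\<gamma> n M * 1 \<le> \<gamma> n M * ?K" by (intro mult_left_mono nonneg) simp
    ultimately show ?thesis by (simp add: divide_le_eq)
  qed
  then have "C\<^sub>2 * (\<gamma> n M / ?K) \<le> C\<^sub>2 * min 1 (\<gamma> n M)" if "n \<ge> 1" for n
    using that assms(2) by (intro mult_left_mono) auto
  then show "lower_bound X M \<phi> (\<lambda>n. C\<^sub>2 / ?K * \<gamma> n M)"
    using assms(1) unfolding optimal_rate_achieved_by_def
    by (elim conjE lower_bound_mono) simp
qed

definition loss :: "real \<Rightarrow> real \<Rightarrow> real" where
  "loss h x = (if h \<le> 1 then h * max 0 (1 - x) + (1 - h) * of_bool (x \<le> 0)
               else (h - 1) * x\<^sup>2 - x + 1)"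

end

theory Submission
  imports Defs
begin

text \<open>Upper bounds. For losses with values in \<open>[0, B]\<close>, Hoeffding's lemma bounds the exponential
  moments of \<open>A(g) - A\<^sub>k(g)\<close>, hence \<open>E max\<^sub>g (A(g) - A\<^sub>k(g)) \<le> B sqrt (ln M / 2k)\<close>; this settles ERM.
  For the hinge loss, convexity and the Gibbs variational inequality show that exponential weighting
  loses at most \<open>ln M / k\<close> in empirical risk against the best \<open>g\<close>, and averaging over \<open>k\<close> only
  costs a constant. For \<open>h > 1\<close> the choice of \<open>\<beta>\<close> makes \<open>exp (- \<phi> / \<beta>)\<close> concave on \<open>[-1, 1]\<close>,
  so the loss of the \<open>k\<close>-th aggregate at the fresh observation \<open>k + 1\<close> is dominated by a telescoping
  difference of log-partition functions.

  Lower bounds. Assouad's lemma on \<open>N \<approx> log\<^sub>2 M\<close> cells of mass \<open>q\<close>, on which the label has mean \<open>\<plusminus>\<epsilon>\<close>,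
  with \<open>n q \<epsilon>\<^sup>2 \<le> 1/2\<close>, so that flipping one sign cannot be detected from \<open>n\<close> observations. The
  dictionary of the \<open>2\<^sup>N\<close> sign patterns does not depend on \<open>n\<close>. For \<open>h \<le> 1\<close> one takes \<open>q = 1/N\<close> and
  \<open>\<epsilon> \<approx> sqrt (N/n)\<close>; for \<open>h > 1\<close> one takes \<open>\<epsilon>\<close> constant and \<open>q \<approx> 1/n\<close>, the remaining mass sitting
  on an uninformative cell.\<close>

section \<open>Risks as integrals\<close>

declare One_nat_def [simp del]

text \<open>One dictionary must serve all \<open>n\<close>, and this decides which parameter of the
  hypercube may vary. For every vertex the dictionary contains a minimizer of the risk over all
  functions, so that its best excess risk is at most 0. For h \<le> 1 such a minimizer takes the
  values \<plusminus>1 on the cells whatever \<epsilon> is, so \<epsilon> may shrink with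
  \<open>n\<close>; for h > 1 it takes the values \<plusminus>\<epsilon> / (2 (h - 1)), so
  \<epsilon> has to stay fixed and q shrinks instead. An undetected sign costs order \<epsilon> per
  unit of mass in the first case and order \<open>\<epsilon>\<^sup>2\<close> in the second.

  A second obstacle: points of an arbitrary measurable space need not be measurable, and an
  arbitrary statistic is unbounded, with possibly infinite risk. The lower bound therefore uses laws
  carried by finitely many representatives of measurable cells, under which every risk is a finite
  sum. In the upper bounds all functions take values in [-1, 1], and the extended expectations
  reduce to Bochner integrals at once.\<close>

definition real_risk :: "(real \<Rightarrow> real) \<Rightarrow> ('a \<times> real) measure \<Rightarrow> ('a \<Rightarrow> real) \<Rightarrow> real" where
  "real_risk \<phi> \<pi> f = (\<integral>z. \<phi> (snd z * f (fst z)) \<partial>\<pi>)"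

lemma ext_expectation_integrable:
  assumes "integrable P Z"
  shows "ext_expectation P (\<lambda>w. ereal (Z w)) = ereal (\<integral>w. Z w \<partial>P)"
proof -
  have "(\<integral>\<^sup>+ w. ennreal (Z w) \<partial>P) \<noteq> \<infinity>" "(\<integral>\<^sup>+ w. ennreal (- Z w) \<partial>P) \<noteq> \<infinity>"
    using assms by (auto simp: real_integrable_def)
  then show ?thesis
    unfolding ext_expectation_def real_lebesgue_integral_def[OF assms]
    by (cases "\<integral>\<^sup>+ w. ennreal (Z w) \<partial>P"; cases "\<integral>\<^sup>+ w. ennreal (- Z w) \<partial>P")
       (auto simp: e2ennreal_ereal)
qed

lemma ext_expectation_cong:
  assumes "\<And>w. w \<in> space P \<Longrightarrow> Z w = Z' w"
  shows "ext_expectation P Z = ext_expectation P Z'"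
  unfolding ext_expectation_def using assms by (simp cong: nn_integral_cong)

lemma ext_expectation_nonneg:
  assumes "\<And>w. w \<in> space P \<Longrightarrow> Z w \<ge> 0"
  shows "ext_expectation P Z = enn2ereal (\<integral>\<^sup>+ w. e2ennreal (Z w) \<partial>P)"
proof -
  have "(\<integral>\<^sup>+ w. e2ennreal (- Z w) \<partial>P) = (\<integral>\<^sup>+ w. 0 \<partial>P)"
    using assms by (intro nn_integral_cong) (auto simp: e2ennreal_neg)
  then show ?thesis unfolding ext_expectation_def by (simp add: zero_ennreal.rep_eq)
qed

text \<open>The negative part is at most \<open>K\<close>, so its integral is finite and the
  difference of the two halves is never \<infinity> - \<infinity>. This keeps the minimal risk away
  from -\<infinity>.\<close>

lemma ext_expectation_lower_bound:
  assumes "prob_space P" and "\<And>w. Z w \<ge> ereal (- K)" and "K \<ge> 0"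
  shows "ext_expectation P Z \<ge> ereal (- K)"
proof -
  interpret prob_space P by fact
  have "e2ennreal (- Z w) \<le> ennreal K" for w
  proof -
    have "- Z w \<le> ereal K" using assms(2)[of w] by (simp add: ereal_uminus_le_reorder)
    then show ?thesis by (metis e2ennreal_ereal e2ennreal_mono)
  qed
  then have "(\<integral>\<^sup>+ w. e2ennreal (- Z w) \<partial>P) \<le> (\<integral>\<^sup>+ w. ennreal K \<partial>P)"
    by (intro nn_integral_mono)
  then have le: "(\<integral>\<^sup>+ w. e2ennreal (- Z w) \<partial>P) \<le> ennreal K" by (simp add: emeasure_space_1)
  then have "enn2ereal (\<integral>\<^sup>+ w. e2ennreal (- Z w) \<partial>P) \<le> ereal K"
    using \<open>K \<ge> 0\<close> by (metis enn2ereal_ennreal less_eq_ennreal.rep_eq)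
  moreover have "0 \<le> enn2ereal (\<integral>\<^sup>+ w. e2ennreal (Z w) \<partial>P)" by simp
  ultimately have "0 - ereal K \<le> ext_expectation P Z"
    unfolding ext_expectation_def by (intro ereal_minus_mono)
  then show ?thesis by simp
qed

lemma risk_eq_real_risk:
  assumes "integrable \<pi> (\<lambda>z. \<phi> (snd z * f (fst z)))"
  shows "risk \<phi> \<pi> f = ereal (real_risk \<phi> \<pi> f)"
  using ext_expectation_integrable[OF assms] by (simp add: risk_def real_risk_def case_prod_unfold)

lemma pair_distributionsD:
  assumes "\<pi> \<in> pair_distributions X"
  shows "prob_space \<pi>" "sets \<pi> = sets (obs_space X)" "space \<pi> = space X \<times> {-1, 1}"
  using assms sets_eq_imp_space_eq[of \<pi> "obs_space X"]
  by (auto simp: pair_distributions_def obs_space_def space_pair_measure)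

lemma measurable_obs_space [measurable]:
  "fst \<in> obs_space X \<rightarrow>\<^sub>M X" "snd \<in> borel_measurable (obs_space X)"
proof -
  show "fst \<in> obs_space X \<rightarrow>\<^sub>M X" unfolding obs_space_def by measurable
  have "(\<lambda>x::real. x) \<in> count_space {-1, 1} \<rightarrow>\<^sub>M borel" by simp
  then show "snd \<in> borel_measurable (obs_space X)"
    unfolding obs_space_def by (rule measurable_compose[OF measurable_snd])
qed

lemma loss_measurable_obs:
  assumes [measurable]: "\<phi> \<in> borel_measurable borel" "f \<in> borel_measurable X"
  shows "(\<lambda>z. \<phi> (snd z * f (fst z))) \<in> borel_measurable (obs_space X)"
  by measurable

text \<open>The argument of the loss stays in [-1, 1] for the functions of a dictionary and their
  averages. Bounds and convexity of the loss are therefore asked only there; the quadratic loss has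
  no upper bound on the line.\<close>

lemma label_times_bounded:
  assumes "y \<in> {-1, 1}" "\<bar>t\<bar> \<le> 1"
  shows "(y::real) * t \<in> {-1..1}"
  using assms by (auto simp: abs_le_iff)

lemma integrable_bounded_loss:
  fixes \<phi> :: "real \<Rightarrow> real"
  assumes \<pi>: "\<pi> \<in> pair_distributions X" and \<phi>: "\<phi> \<in> borel_measurable borel"
    and B: "\<And>t. t \<in> {-1..1} \<Longrightarrow> \<bar>\<phi> t\<bar> \<le> B"
    and f: "f \<in> borel_measurable X" "\<And>x. x \<in> space X \<Longrightarrow> \<bar>f x\<bar> \<le> 1"
  shows "integrable \<pi> (\<lambda>z. \<phi> (snd z * f (fst z)))"
proof -
  note D = pair_distributionsD[OF \<pi>]
  interpret prob_space \<pi> by (rule D)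
  have m: "(\<lambda>z. \<phi> (snd z * f (fst z))) \<in> borel_measurable \<pi>"
    using loss_measurable_obs[OF \<phi> f(1)] by (simp add: measurable_cong_sets[OF D(2) refl])
  show ?thesis
  proof (rule integrable_const_bound[where B = B])
    show "(\<lambda>z. \<phi> (snd z * f (fst z))) \<in> borel_measurable \<pi>" by (rule m)
    show "AE z in \<pi>. norm (\<phi> (snd z * f (fst z))) \<le> B"
    proof (rule AE_I2)
      fix z assume "z \<in> space \<pi>"
      then have "snd z \<in> {-1, 1}" "fst z \<in> space X" by (auto simp: D(3))
      then have "snd z * f (fst z) \<in> {-1..1}" using f(2) by (intro label_times_bounded)
      then show "norm (\<phi> (snd z * f (fst z))) \<le> B" using B by simp
    qed
  qed
qed

lemma real_risk_bounds:
  assumes \<pi>: "\<pi> \<in> pair_distributions X" and \<phi>: "\<phi> \<in> borel_measurable borel"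
    and B: "\<And>t. t \<in> {-1..1} \<Longrightarrow> \<phi> t \<in> {a..b}"
    and f: "f \<in> borel_measurable X" "\<And>x. x \<in> space X \<Longrightarrow> \<bar>f x\<bar> \<le> 1"
  shows "real_risk \<phi> \<pi> f \<in> {a..b}"
proof -
  note D = pair_distributionsD[OF \<pi>]
  interpret prob_space \<pi> by (rule D)
  have "\<bar>\<phi> t\<bar> \<le> max \<bar>a\<bar> \<bar>b\<bar>" if "t \<in> {-1..1}" for t using B[OF that] by auto
  then have int: "integrable \<pi> (\<lambda>z. \<phi> (snd z * f (fst z)))"
    by (rule integrable_bounded_loss[OF \<pi> \<phi> _ f])
  have bd: "\<phi> (snd z * f (fst z)) \<in> {a..b}" if "z \<in> space \<pi>" for z
  proof -
    have "snd z \<in> {-1, 1}" "fst z \<in> space X" using that by (auto simp: D(3))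
    then show ?thesis using f(2) by (intro B label_times_bounded)
  qed
  have "a \<le> real_risk \<phi> \<pi> f" unfolding real_risk_def
    using bd by (intro integral_ge_const[OF int] AE_I2) auto
  moreover have "real_risk \<phi> \<pi> f \<le> b" unfolding real_risk_def
    using bd by (intro integral_le_const[OF int] AE_I2) auto
  ultimately show ?thesis by simp
qed

text \<open>Finiteness lets \<open>min_risk\<close> cancel from both sides of an excess risk
  inequality. From above it is bounded by the zero function, of risk \<open>\<phi> 0\<close>; from
  below, a bound on \<phi> over the whole line is used because the infimum also runs over unbounded
  functions.\<close>

lemma min_risk_finite:
  assumes \<pi>: "\<pi> \<in> pair_distributions X" and K: "\<And>t. \<phi> t \<ge> - K"
  obtains m where "min_risk \<phi> X \<pi> = ereal m"
proof -
  interpret prob_space \<pi> using pair_distributionsD[OF \<pi>] by simp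
  have "min_risk \<phi> X \<pi> \<ge> ereal (- max K 0)" unfolding min_risk_def risk_def
  proof (intro INF_greatest ext_expectation_lower_bound prob_space_axioms)
    show "ereal (- max K 0) \<le> (case w of (x, y) \<Rightarrow> ereal (\<phi> (y * f x)))" for w f
      using K[of "snd w * f (fst w)"] by (auto split: prod.splits simp: max_def)
  qed simp
  moreover have "min_risk \<phi> X \<pi> \<le> risk \<phi> \<pi> (\<lambda>_. 0)" unfolding min_risk_def by (intro INF_lower) simp
  moreover have "risk \<phi> \<pi> (\<lambda>_. 0) = ereal (\<phi> 0)"
    by (subst risk_eq_real_risk) (simp_all add: real_risk_def prob_space)
  ultimately have "\<exists>m. min_risk \<phi> X \<pi> = ereal m" by (cases "min_risk \<phi> X \<pi>") auto
  then show ?thesis using that by blast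
qed

lemma dictionariesD:
  assumes "F \<in> dictionaries X M" "M \<ge> 1"
  shows "finite F" "F \<noteq> {}" "card F = M"
    "\<And>g. g \<in> F \<Longrightarrow> g \<in> borel_measurable X"
    "\<And>g x. g \<in> F \<Longrightarrow> x \<in> space X \<Longrightarrow> \<bar>g x\<bar> \<le> 1"
proof -
  show "\<bar>g x\<bar> \<le> 1" if "g \<in> F" "x \<in> space X" for g x
  proof -
    have "g \<in> space X \<rightarrow>\<^sub>E {-1..1}" using assms(1) that(1) by (auto simp: dictionaries_def)
    then have "g x \<in> {-1..1}" using that(2) by (rule PiE_mem)
    then show ?thesis by auto
  qed
qed (use assms in \<open>auto simp: dictionaries_def\<close>)

section \<open>Samples, statistics, and the reduction of the upper bound to real integrals\<close>

lemma prob_space_sample: "prob_space \<pi> \<Longrightarrow> prob_space (PiM {1..n::nat} (\<lambda>_. \<pi>))"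
  by (rule prob_space_PiM)

lemma sets_sample:
  assumes "\<pi> \<in> pair_distributions X"
  shows "sets (PiM {1..n} (\<lambda>_. \<pi>)) = sets (sample_space X n)"
  unfolding sample_space_def using pair_distributionsD[OF assms] by (intro sets_PiM_cong) auto

lemma space_sample:
  assumes "\<pi> \<in> pair_distributions X"
  shows "space (PiM {1..n} (\<lambda>_. \<pi>)) = space (sample_space X n)"
  using sets_eq_imp_space_eq[OF sets_sample[OF assms]] .

lemma sample_space_component:
  assumes "D \<in> space (sample_space X n)" "i \<in> {1..n}"
  shows "fst (D i) \<in> space X" "snd (D i) \<in> {-1, 1}"
proof -
  have "D i \<in> space (obs_space X)"
    using assms(2) PiE_mem[of D "{1..n}" "\<lambda>_. space (obs_space X)" i] assms(1)
    by (simp add: sample_space_def space_PiM)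
  then show "fst (D i) \<in> space X" "snd (D i) \<in> {-1, 1}"
    by (auto simp: obs_space_def space_pair_measure)
qed

lemma statistic_section:
  assumes "statistic X f" "n \<ge> 1" "D \<in> space (sample_space X n)"
  shows "f n D \<in> borel_measurable X"
proof -
  have "(\<lambda>(D, x). f n D x) \<in> borel_measurable (sample_space X n \<Otimes>\<^sub>M X)"
    using assms unfolding statistic_def by blast
  from measurable_Pair2[OF this assms(3)] show ?thesis by simp
qed

lemma real_risk_measurable:
  assumes \<pi>: "\<pi> \<in> pair_distributions X" and \<phi>[measurable]: "\<phi> \<in> borel_measurable borel"
    and f[measurable]: "(\<lambda>(D, x). f D x) \<in> borel_measurable (S \<Otimes>\<^sub>M X)"
  shows "(\<lambda>D. real_risk \<phi> \<pi> (f D)) \<in> borel_measurable S"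
proof -
  note D = pair_distributionsD[OF \<pi>]
  interpret prob_space \<pi> by (rule D)
  note [measurable_cong] = D(2)
  have "(\<lambda>(D, z). \<phi> (snd z * f D (fst z))) \<in> borel_measurable (S \<Otimes>\<^sub>M \<pi>)"
    by measurable
  then show ?thesis unfolding real_risk_def by (rule borel_measurable_lebesgue_integral)
qed

text \<open>All upper bounds pass through this reduction. For a statistic with values in [-1, 1] the
  risk is bounded and measurable in the sample, so the extended expectation is a Bochner integral;
  the finite minimal risk cancels, and the minimum over \<open>F\<close> is attained at some
  \<open>g\<close>.\<close>

lemma expected_excess_risk_le:
  assumes \<pi>: "\<pi> \<in> pair_distributions X" and \<phi>: "\<phi> \<in> borel_measurable borel"
    and B: "\<And>t. t \<in> {-1..1} \<Longrightarrow> \<bar>\<phi> t\<bar> \<le> B" and K: "\<And>t. \<phi> t \<ge> - K"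
    and F: "F \<in> dictionaries X M" "M \<ge> 1" and f: "statistic X f" and n: "n \<ge> 1"
    and f1: "\<And>D x. D \<in> space (sample_space X n) \<Longrightarrow> x \<in> space X \<Longrightarrow> \<bar>f n D x\<bar> \<le> 1"
    and le: "\<And>g. g \<in> F \<Longrightarrow> (\<integral>D. real_risk \<phi> \<pi> (f n D) \<partial>PiM {1..n} (\<lambda>_. \<pi>)) \<le> real_risk \<phi> \<pi> g + r"
  shows "expected_excess_risk \<phi> X \<pi> f n \<le> (MIN g\<in>F. excess_risk \<phi> X \<pi> g) + ereal r"
proof -
  note D = pair_distributionsD[OF \<pi>] and FD = dictionariesD[OF F]
  let ?P = "PiM {1..n} (\<lambda>_. \<pi>)"
  interpret P: prob_space ?P by (intro prob_space_sample D)
  obtain m where m: "min_risk \<phi> X \<pi> = ereal m" using min_risk_finite[OF \<pi> K] .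
  have risk: "risk \<phi> \<pi> g = ereal (real_risk \<phi> \<pi> g)"
    if "g \<in> borel_measurable X" "\<And>x. x \<in> space X \<Longrightarrow> \<bar>g x\<bar> \<le> 1" for g
    by (intro risk_eq_real_risk integrable_bounded_loss[OF \<pi> \<phi> B] that)
  have ex: "excess_risk \<phi> X \<pi> (f n D) = ereal (real_risk \<phi> \<pi> (f n D) - m)" if "D \<in> space ?P" for D
    using that unfolding excess_risk_def m space_sample[OF \<pi>]
    by (subst risk) (auto intro: statistic_section[OF f n] f1)
  have meas: "(\<lambda>D. real_risk \<phi> \<pi> (f n D)) \<in> borel_measurable ?P"
    unfolding measurable_cong_sets[OF sets_sample[OF \<pi>] refl]
    using f n by (intro real_risk_measurable[OF \<pi> \<phi>]) (auto simp: statistic_def)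
  have int: "integrable ?P (\<lambda>D. real_risk \<phi> \<pi> (f n D))"
  proof (rule P.integrable_const_bound[OF _ meas], rule AE_I2)
    fix D assume "D \<in> space ?P"
    then have "D \<in> space (sample_space X n)" by (simp only: space_sample[OF \<pi>])
    moreover have "\<phi> t \<in> {-B..B}" if "t \<in> {-1..1}" for t using B[OF that] by auto
    ultimately have "real_risk \<phi> \<pi> (f n D) \<in> {-B..B}"
      by (intro real_risk_bounds[OF \<pi> \<phi>] statistic_section[OF f n] f1) auto
    then show "norm (real_risk \<phi> \<pi> (f n D)) \<le> B" by auto
  qed
  have "expected_excess_risk \<phi> X \<pi> f n = ext_expectation ?P (\<lambda>D. ereal (real_risk \<phi> \<pi> (f n D) - m))"
    unfolding expected_excess_risk_def using ex by (intro ext_expectation_cong)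
  also have "\<dots> = ereal (\<integral>D. real_risk \<phi> \<pi> (f n D) - m \<partial>?P)"
    by (intro ext_expectation_integrable Bochner_Integration.integrable_diff int P.integrable_const)
  also have "(\<integral>D. real_risk \<phi> \<pi> (f n D) - m \<partial>?P) = (\<integral>D. real_risk \<phi> \<pi> (f n D) \<partial>?P) - m"
    using int by (simp add: P.prob_space)
  finally have eq: "expected_excess_risk \<phi> X \<pi> f n = \<dots>" .
  have "(MIN g\<in>F. excess_risk \<phi> X \<pi> g) \<in> excess_risk \<phi> X \<pi> ` F"
    using FD by (intro Min_in) auto
  then obtain g where g: "g \<in> F" "(MIN g\<in>F. excess_risk \<phi> X \<pi> g) = excess_risk \<phi> X \<pi> g" by auto
  have "excess_risk \<phi> X \<pi> g = ereal (real_risk \<phi> \<pi> g - m)"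
    unfolding excess_risk_def m by (subst risk) (auto intro: FD(4,5)[OF g(1)])
  then show ?thesis unfolding eq g(2) using le[OF g(1)] by simp
qed

lemma emp_risk_measurable:
  assumes [measurable]: "\<phi> \<in> borel_measurable borel" "g \<in> borel_measurable X" and k: "k \<le> n"
  shows "(\<lambda>D. emp_risk \<phi> k D g) \<in> borel_measurable (sample_space X n)"
proof -
  have "(\<lambda>D. D i) \<in> sample_space X n \<rightarrow>\<^sub>M obs_space X" if "i \<in> {1..k}" for i
    unfolding sample_space_def using that k by (intro measurable_component_singleton) auto
  then have "(\<lambda>D. \<phi> (snd (D i) * g (fst (D i)))) \<in> borel_measurable (sample_space X n)"
    if "i \<in> {1..k}" for i
    using measurable_compose[OF _ loss_measurable_obs[OF assms(1,2)]] that by blast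
  then have "(\<lambda>D. \<Sum>i=1..k. \<phi> (snd (D i) * g (fst (D i)))) \<in> borel_measurable (sample_space X n)"
    by (intro borel_measurable_sum)
  then show ?thesis unfolding emp_risk_def by simp
qed

section \<open>Maximal deviations and empirical risk minimization\<close>

lemma emp_risk_bounds:
  assumes B: "\<And>t. t \<in> {-1..1} \<Longrightarrow> \<phi> t \<in> {0..B}" and "D \<in> space (sample_space X n)" "k \<le> n"
    and g: "\<And>x. x \<in> space X \<Longrightarrow> \<bar>g x\<bar> \<le> 1" and "B \<ge> 0"
  shows "emp_risk \<phi> k D g \<in> {0..B}"
proof -
  have b: "\<phi> (snd (D i) * g (fst (D i))) \<in> {0..B}" if "i \<in> {1..k}" for i
    using sample_space_component[OF assms(2), of i] that assms(3)
    by (intro B label_times_bounded g) auto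
  have "(\<Sum>i=1..k. \<phi> (snd (D i) * g (fst (D i)))) \<le> of_nat (card {1..k}) * B"
    using b by (intro sum_bounded_above) auto
  \<comment> \<open>\<open>B \<ge> 0\<close> covers \<open>k = 0\<close>, where
    \<open>emp_risk\<close> is 0 by the convention for division by 0.\<close>
  then have "emp_risk \<phi> k D g \<le> B"
    using \<open>B \<ge> 0\<close> unfolding emp_risk_def by (cases "k = 0") (auto simp: field_simps)
  moreover have "0 \<le> emp_risk \<phi> k D g" unfolding emp_risk_def
    using b by (intro mult_nonneg_nonneg sum_nonneg) auto
  ultimately show ?thesis by simp
qed

text \<open>The first \<open>k\<close> observations are read off a sample of size \<open>n\<close>,
  because CAEW compares aggregates of all sizes \<open>k \<le> n\<close> on one probability
  space.\<close>

lemma emp_risk_integral: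
  fixes \<phi> :: "real \<Rightarrow> real"
  assumes \<pi>: "\<pi> \<in> pair_distributions X"
    and int: "integrable \<pi> (\<lambda>z. \<phi> (snd z * g (fst z)))" and k: "1 \<le> k" "k \<le> n"
  shows "integrable (PiM {1..n} (\<lambda>_. \<pi>)) (\<lambda>D. emp_risk \<phi> k D g)"
    and "(\<integral>D. emp_risk \<phi> k D g \<partial>PiM {1..n} (\<lambda>_. \<pi>)) = real_risk \<phi> \<pi> g"
proof -
  note D = pair_distributionsD[OF \<pi>]
  let ?P = "PiM {1..n} (\<lambda>_. \<pi>)" and ?l = "\<lambda>z. \<phi> (snd z * g (fst z))"
  have comp: "distr ?P \<pi> (\<lambda>D. D i) = \<pi>" if "i \<in> {1..k}" for i
    using that k D by (intro distr_PiM_component) auto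
  have m: "(\<lambda>D. D i) \<in> ?P \<rightarrow>\<^sub>M \<pi>" if "i \<in> {1..k}" for i
    using that k by (intro measurable_component_singleton) auto
  have i1: "integrable ?P (\<lambda>D. ?l (D i))" if "i \<in> {1..k}" for i
    using integrable_distr[OF m[OF that], of ?l] int comp[OF that] by simp
  have i2: "(\<integral>D. ?l (D i) \<partial>?P) = real_risk \<phi> \<pi> g" if "i \<in> {1..k}" for i
    using integral_distr[OF m[OF that], of ?l] int comp[OF that] by (simp add: real_risk_def)
  show "integrable ?P (\<lambda>D. emp_risk \<phi> k D g)" unfolding emp_risk_def
    using i1 by (intro integrable_mult_right Bochner_Integration.integrable_sum)
  show "(\<integral>D. emp_risk \<phi> k D g \<partial>?P) = real_risk \<phi> \<pi> g" unfolding emp_risk_def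
    using k i1 i2 by (subst integral_mult_right_zero, subst Bochner_Integration.integral_sum) auto
qed

text \<open>The exponential of the deviation factorizes over the observations, with parameter s = l
  / k for each of them. Hoeffding's lemma bounds one factor by
  \<open>exp (s\<^sup>2 * B\<^sup>2 / 8)\<close>, and there are \<open>k\<close> of them.\<close>

lemma exp_deviation_le:
  fixes \<phi> :: "real \<Rightarrow> real"
  assumes \<pi>: "\<pi> \<in> pair_distributions X" and \<phi>: "\<phi> \<in> borel_measurable borel"
    and B: "\<And>t. t \<in> {-1..1} \<Longrightarrow> \<phi> t \<in> {0..B}"
    and g: "g \<in> borel_measurable X" "\<And>x. x \<in> space X \<Longrightarrow> \<bar>g x\<bar> \<le> 1"
    and k: "1 \<le> k" "k \<le> n" and l: "l > 0"
  shows "integrable (PiM {1..n} (\<lambda>_. \<pi>)) (\<lambda>D. exp (l * (real_risk \<phi> \<pi> g - emp_risk \<phi> k D g)))"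
    and "(\<integral>D. exp (l * (real_risk \<phi> \<pi> g - emp_risk \<phi> k D g)) \<partial>PiM {1..n} (\<lambda>_. \<pi>))
           \<le> exp (l\<^sup>2 * B\<^sup>2 / (8 * real k))"
proof -
  note D = pair_distributionsD[OF \<pi>]
  interpret prob_space \<pi> by (rule D)
  interpret product_sigma_finite "\<lambda>_::nat. \<pi>" ..
  let ?P = "PiM {1..n} (\<lambda>_. \<pi>)" and ?l = "\<lambda>z. \<phi> (snd z * g (fst z))"
  let ?R = "real_risk \<phi> \<pi> g"
  define s where "s = l / k"
  have s: "s > 0" using l k by (simp add: s_def)
  have m[measurable]: "?l \<in> borel_measurable \<pi>"
    using loss_measurable_obs[OF \<phi> g(1)] by (simp add: measurable_cong_sets[OF D(2) refl])
  have bd: "?l z \<in> {0..B}" if "z \<in> space \<pi>" for z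
  proof -
    have "snd z \<in> {-1, 1}" "fst z \<in> space X" using that by (auto simp: D(3))
    then show ?thesis using g(2) by (intro B label_times_bounded)
  qed
  define E where "E = (\<lambda>z. exp (s * (?R - ?l z)))"
  \<comment> \<open>The negated loss is used because the deviation is the risk minus the empirical
    risk.\<close>
  interpret h: interval_bounded_random_variable \<pi> "\<lambda>z. - ?l z" "- B" 0
    by unfold_locales (use bd in \<open>auto intro!: AE_I2\<close>)
  have "(\<integral>\<^sup>+ z. ennreal (exp (s * (- ?l z - expectation (\<lambda>z. - ?l z)))) \<partial>\<pi>)
          \<le> ennreal (exp (s\<^sup>2 * (0 - - B)\<^sup>2 / 8))"
    by (rule h.Hoeffdings_lemma_nn_integral[OF s])
  then have nn: "(\<integral>\<^sup>+ z. ennreal (E z) \<partial>\<pi>) \<le> ennreal (exp (s\<^sup>2 * B\<^sup>2 / 8))"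
    by (simp add: E_def real_risk_def algebra_simps)
  have iE: "integrable \<pi> E"
    unfolding integrable_iff_bounded using nn by (auto simp: E_def less_top[symmetric] top_unique)
  have "ennreal (expectation E) = (\<integral>\<^sup>+ z. ennreal (E z) \<partial>\<pi>)"
    using iE by (intro nn_integral_eq_integral[symmetric]) (auto simp: E_def)
  then have EE: "expectation E \<le> exp (s\<^sup>2 * B\<^sup>2 / 8)" using nn by (metis ennreal_le_iff exp_ge_zero)
  have E0: "expectation E \<ge> 0" by (intro Bochner_Integration.integral_nonneg) (simp add: E_def)
  \<comment> \<open>Coordinates beyond \<open>k\<close> get the factor 1, so that the product runs
    over the whole index set of the product measure.\<close>
  define G where "G = (\<lambda>i z. if i \<le> k then E z else 1)"
  have eq: "exp (l * (?R - emp_risk \<phi> k D g)) = (\<Prod>i\<in>{1..n}. G i (D i))" for D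
  proof -
    have "(\<Prod>i\<in>{1..n}. G i (D i)) = (\<Prod>i\<in>{1..k}. G i (D i))"
      using k by (intro prod.mono_neutral_right) (auto simp: G_def)
    also have "\<dots> = (\<Prod>i\<in>{1..k}. E (D i))" by (intro prod.cong) (auto simp: G_def)
    also have "\<dots> = exp (\<Sum>i\<in>{1..k}. s * (?R - ?l (D i)))" by (simp add: E_def exp_sum)
    also have "(\<Sum>i\<in>{1..k}. s * (?R - ?l (D i))) = s * (k * ?R - (\<Sum>i\<in>{1..k}. ?l (D i)))"
      by (simp add: sum_distrib_left[symmetric] sum_subtractf)
    also have "\<dots> = l * (?R - emp_risk \<phi> k D g)"
      using k by (simp add: s_def emp_risk_def field_simps)
    finally show ?thesis by simp
  qed
  have iG: "integrable \<pi> (G i)" for i using iE by (cases "i \<le> k") (simp_all add: G_def)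
  show "integrable ?P (\<lambda>D. exp (l * (?R - emp_risk \<phi> k D g)))"
    unfolding eq using iG by (intro product_integrable_prod) auto
  have "(\<integral>D. exp (l * (?R - emp_risk \<phi> k D g)) \<partial>?P) = (\<Prod>i\<in>{1..n}. expectation (G i))"
    unfolding eq using iG by (intro product_integral_prod) auto
  also have "\<dots> = (\<Prod>i\<in>{1..k}. expectation (G i))"
    using k by (intro prod.mono_neutral_right) (auto simp: G_def prob_space)
  also have "\<dots> = (\<Prod>i\<in>{1..k}. expectation E)"
    by (intro prod.cong) (auto simp: G_def intro!: Bochner_Integration.integral_cong)
  also have "\<dots> = expectation E ^ k" by simp
  also have "\<dots> \<le> exp (s\<^sup>2 * B\<^sup>2 / 8) ^ k" by (intro power_mono EE E0)
  also have "\<dots> = exp (l\<^sup>2 * B\<^sup>2 / (8 * real k))"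
    using k by (simp add: exp_of_nat_mult[symmetric] s_def power2_eq_square field_simps)
  finally show "(\<integral>D. exp (l * (?R - emp_risk \<phi> k D g)) \<partial>?P) \<le> exp (l\<^sup>2 * B\<^sup>2 / (8 * real k))" .
qed

text \<open>The maximal deviation appears only through a function \<open>W\<close> that is pointwise
  below some deviation; the dominating \<open>g\<close> may depend on the sample and need not be
  chosen measurably. In place of Jensen's inequality for exp, the proof uses the tangent line
  inequality u \<le> exp (u - c) + c - 1.\<close>

lemma expectation_max_deviation_le:
  fixes \<phi> :: "real \<Rightarrow> real"
  assumes \<pi>: "\<pi> \<in> pair_distributions X" and \<phi>: "\<phi> \<in> borel_measurable borel"
    and B: "\<And>t. t \<in> {-1..1} \<Longrightarrow> \<phi> t \<in> {0..B}" "B > 0"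
    and F: "F \<in> dictionaries X M" "M \<ge> 2"
    and k: "1 \<le> k" "k \<le> n"
    and W: "integrable (PiM {1..n} (\<lambda>_. \<pi>)) W"
    and dom: "\<And>D. D \<in> space (sample_space X n) \<Longrightarrow> \<exists>g\<in>F. W D \<le> real_risk \<phi> \<pi> g - emp_risk \<phi> k D g"
  shows "(\<integral>D. W D \<partial>PiM {1..n} (\<lambda>_. \<pi>)) \<le> B * sqrt (ln M / (2 * real k))"
proof -
  note D = pair_distributionsD[OF \<pi>]
  have M1: "M \<ge> 1" using F by simp
  note FD = dictionariesD[OF F(1) M1]
  let ?P = "PiM {1..n} (\<lambda>_. \<pi>)"
  interpret P: prob_space ?P by (intro prob_space_sample D)
  \<comment> \<open>With this parameter the bound on each exponential moment is exactly
    \<open>M\<close>.\<close>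
  define l where "l = sqrt (8 * k * ln M) / B"
  have lnM: "ln M > 0" using F by simp
  then have l: "l > 0" using k B by (simp add: l_def)
  have l2: "l\<^sup>2 * B\<^sup>2 / (8 * real k) = ln M"
    using k B lnM by (simp add: l_def power_divide real_sqrt_pow2)
  \<comment> \<open>The \<open>M\<close> exponential moments, each at most \<open>M\<close>, sum to
    at most exp c, so the tangent line bound closes as l E W \<le> 1 + (c - 1) = c.\<close>
  define c where "c = 2 * ln M"
  define d where "d = (\<lambda>g D. exp (l * (real_risk \<phi> \<pi> g - emp_risk \<phi> k D g)))"
  have id: "integrable ?P (d g)" and d: "(\<integral>D. d g D \<partial>?P) \<le> M" if "g \<in> F" for g
  proof -
    show "integrable ?P (d g)" unfolding d_def
      by (rule exp_deviation_le[OF \<pi> \<phi> B(1) FD(4,5)[OF that] k l])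
    have "(\<integral>D. d g D \<partial>?P) \<le> exp (l\<^sup>2 * B\<^sup>2 / (8 * real k))" unfolding d_def
      by (rule exp_deviation_le[OF \<pi> \<phi> B(1) FD(4,5)[OF that] k l])
    then show "(\<integral>D. d g D \<partial>?P) \<le> M" unfolding l2 using F by simp
  qed
  have pt: "l * W D \<le> exp (- c) * (\<Sum>g\<in>F. d g D) + (c - 1)" if "D \<in> space ?P" for D
  proof -
    have "D \<in> space (sample_space X n)" using that by (simp only: space_sample[OF \<pi>])
    from dom[OF this] obtain g where g: "g \<in> F" "W D \<le> real_risk \<phi> \<pi> g - emp_risk \<phi> k D g" by auto
    define u where "u = l * (real_risk \<phi> \<pi> g - emp_risk \<phi> k D g)"
    have "l * W D \<le> u" unfolding u_def using g l by simp
    also have "u \<le> exp (u - c) + (c - 1)" using exp_ge_add_one_self[of "u - c"] by linarith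
    also have "exp (u - c) = exp (- c) * d g D" by (simp add: d_def u_def exp_add[symmetric])
    also have "d g D \<le> (\<Sum>g\<in>F. d g D)" using g FD(1) by (intro member_le_sum) (auto simp: d_def)
    finally show ?thesis by simp
  qed
  have "l * (\<integral>D. W D \<partial>?P) = (\<integral>D. l * W D \<partial>?P)" by simp
  also have "\<dots> \<le> (\<integral>D. exp (- c) * (\<Sum>g\<in>F. d g D) + (c - 1) \<partial>?P)"
    using pt W id by (intro integral_mono) auto
  also have "\<dots> = exp (- c) * (\<Sum>g\<in>F. \<integral>D. d g D \<partial>?P) + (c - 1)"
    using id by (subst Bochner_Integration.integral_add) (auto simp: P.prob_space)
  also have "(\<Sum>g\<in>F. \<integral>D. d g D \<partial>?P) \<le> real (card F) * real M" using d by (intro sum_bounded_above) auto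
  also have "real (card F) * real M = exp c"
    using F(2) unfolding c_def mult_2 exp_add FD(3) by simp
  finally have "l * (\<integral>D. W D \<partial>?P) \<le> c" by (simp add: exp_add[symmetric])
  then have "(\<integral>D. W D \<partial>?P) \<le> c / l" using l by (simp add: field_simps)
  also have "c / l = B * sqrt (ln M / (2 * real k))"
  proof (rule power2_eq_imp_eq)
    show "(c / l)\<^sup>2 = (B * sqrt (ln M / (2 * real k)))\<^sup>2"
      using k B lnM unfolding c_def l_def
      by (simp add: power_divide power_mult_distrib real_sqrt_pow2) (simp add: field_simps power2_eq_square)
  qed (use l lnM B k in \<open>auto simp: c_def\<close>)
  finally show ?thesis .
qed

section \<open>Empirical risk minimization\<close>

text \<open>A minimizer has to be selected measurably in the sample. The dictionary is enumerated
  and the least minimizing index is taken: it takes countably many values and is determined by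
  comparisons of measurable empirical risks.\<close>

lemma ERM_exists:
  fixes \<phi> :: "real \<Rightarrow> real"
  assumes \<phi>[measurable]: "\<phi> \<in> borel_measurable borel" and F: "F \<in> dictionaries X M" "M \<ge> 1"
  shows "\<exists>f. statistic X f \<and> ERM \<phi> X F f"
proof -
  note FD = dictionariesD[OF F]
  obtain e where e: "bij_betw e {0..<M} F"
    using ex_bij_betw_nat_finite[OF FD(1)] FD(3) by auto
  \<comment> \<open>The default value 0 beyond \<open>M\<close> gives a sequence of measurable
    functions on all of nat, as composition with a countably valued index requires.\<close>
  define e' where "e' = (\<lambda>i. if i < M then e i else (\<lambda>_. 0))"
  have eF: "e' i \<in> F" if "i < M" for i using e that by (auto simp: e'_def bij_betw_def)
  define best where "best = (\<lambda>n D i. i < M \<and> (\<forall>j\<in>{0..<M}. emp_risk \<phi> n D (e' i) \<le> emp_risk \<phi> n D (e' j)))"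
  define f :: "'a estimator" where "f = (\<lambda>n D. e' (LEAST i. best n D i))"
  have ex: "\<exists>i. best n D i" for n D
  proof -
    have "\<exists>i\<in>{0..<M}. \<forall>j\<in>{0..<M}. emp_risk \<phi> n D (e' i) \<le> emp_risk \<phi> n D (e' j)"
      using F(2) ex_is_arg_min_if_finite[of "{0..<M}" "\<lambda>i. emp_risk \<phi> n D (e' i)"]
      unfolding is_arg_min_linorder by fastforce
    then show ?thesis by (auto simp: best_def)
  qed
  have "is_arg_min (emp_risk \<phi> n D) (\<lambda>g. g \<in> F) (f n D)" for n D
  proof -
    have b: "best n D (LEAST i. best n D i)" using ex by (rule LeastI_ex)
    have "emp_risk \<phi> n D (f n D) \<le> emp_risk \<phi> n D g" if "g \<in> F" for g
    proof -
      obtain j where "j < M" "g = e' j" using e \<open>g \<in> F\<close> by (auto simp: bij_betw_def e'_def)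
      then show ?thesis using b by (auto simp: best_def f_def)
    qed
    then show ?thesis using b eF by (auto simp: is_arg_min_linorder f_def best_def)
  qed
  moreover have "statistic X f" unfolding statistic_def
  proof (intro allI impI)
    fix n
    have [measurable]: "e' i \<in> borel_measurable X" for i
      using FD(4) eF by (cases "i < M") (auto simp: e'_def)
    have [measurable]: "(\<lambda>D. emp_risk \<phi> n D (e' i)) \<in> borel_measurable (sample_space X n)" for i
      by (rule emp_risk_measurable) auto
    have [measurable]: "(\<lambda>p. LEAST i. best n (fst p) i) \<in> sample_space X n \<Otimes>\<^sub>M X \<rightarrow>\<^sub>M count_space UNIV"
      unfolding best_def by measurable
    have "(\<lambda>p. e' (LEAST i. best n (fst p) i) (snd p)) \<in> borel_measurable (sample_space X n \<Otimes>\<^sub>M X)"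
      by (rule measurable_compose_countable) measurable
    then show "(\<lambda>(D, x). f n D x) \<in> borel_measurable (sample_space X n \<Otimes>\<^sub>M X)"
      by (simp add: f_def case_prod_unfold)
  qed
  ultimately show ?thesis unfolding ERM_def by blast
qed

lemma integrable_real_risk:
  fixes \<phi> :: "real \<Rightarrow> real"
  assumes \<pi>: "\<pi> \<in> pair_distributions X" and \<phi>: "\<phi> \<in> borel_measurable borel"
    and B: "\<And>t. t \<in> {-1..1} \<Longrightarrow> \<bar>\<phi> t\<bar> \<le> B"
    and f: "(\<lambda>(D, x). f D x) \<in> borel_measurable (sample_space X n \<Otimes>\<^sub>M X)"
      "\<And>D x. D \<in> space (sample_space X n) \<Longrightarrow> x \<in> space X \<Longrightarrow> \<bar>f D x\<bar> \<le> 1"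
  shows "integrable (PiM {1..n} (\<lambda>_. \<pi>)) (\<lambda>D. real_risk \<phi> \<pi> (f D))"
proof -
  note D = pair_distributionsD[OF \<pi>]
  interpret P: prob_space "PiM {1..n} (\<lambda>_. \<pi>)" by (intro prob_space_sample D)
  show ?thesis
  proof (rule P.integrable_const_bound[where B = B])
    show "(\<lambda>D. real_risk \<phi> \<pi> (f D)) \<in> borel_measurable (PiM {1..n} (\<lambda>_. \<pi>))"
      unfolding measurable_cong_sets[OF sets_sample[OF \<pi>] refl] by (rule real_risk_measurable[OF \<pi> \<phi> f(1)])
    show "AE D in PiM {1..n} (\<lambda>_. \<pi>). norm (real_risk \<phi> \<pi> (f D)) \<le> B"
    proof (rule AE_I2)
      fix D assume "D \<in> space (PiM {1..n} (\<lambda>_. \<pi>))"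
      then have "D \<in> space (sample_space X n)" by (simp only: space_sample[OF \<pi>])
      moreover have "\<phi> t \<in> {-B..B}" if "t \<in> {-1..1}" for t using B[OF that] by auto
      moreover have "f D \<in> borel_measurable X" using measurable_Pair2[OF f(1) calculation(1)] by simp
      ultimately have "real_risk \<phi> \<pi> (f D) \<in> {-B..B}"
        by (intro real_risk_bounds[OF \<pi> \<phi>] f(2)) auto
      then show "norm (real_risk \<phi> \<pi> (f D)) \<le> B" by auto
    qed
  qed
qed

text \<open>For a fixed competitor \<open>g\<close>, replacing its empirical risk by the smaller one
  of the minimizer bounds the difference by the deviation at a random element of \<open>F\<close>,
  while the empirical risk of \<open>g\<close> has the right expectation. The jump of the loss at 0
  is harmless here.\<close>

lemma upper_bound_ERM:
  fixes \<phi> :: "real \<Rightarrow> real"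
  assumes \<phi>: "\<phi> \<in> borel_measurable borel" and B: "\<And>t. t \<in> {-1..1} \<Longrightarrow> \<phi> t \<in> {0..B}" "B > 0"
    and pos: "\<And>t. \<phi> t \<ge> 0" and M: "M \<ge> 2"
  shows "upper_bound_by X M \<phi> (ERM \<phi>) (\<lambda>n. B * sqrt (ln M / (2 * real n)))"
  unfolding upper_bound_by_def
proof (intro ballI conjI allI impI; (elim conjE)?)
  fix F assume F: "F \<in> dictionaries X M"
  have M1: "M \<ge> 1" using M by simp
  note FD = dictionariesD[OF F M1]
  have B': "\<bar>\<phi> t\<bar> \<le> B" if "t \<in> {-1..1}" for t using B(1)[OF that] by auto
  show "\<exists>f. statistic X f \<and> ERM \<phi> X F f" using ERM_exists[OF \<phi> F M1] .
  fix f \<pi> and n :: nat assume f: "statistic X f" "ERM \<phi> X F f" and \<pi>: "\<pi> \<in> pair_distributions X" and n: "n \<ge> 1"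
  note D = pair_distributionsD[OF \<pi>]
  let ?P = "PiM {1..n} (\<lambda>_. \<pi>)"
  have fF: "f n D \<in> F" and opt: "g \<in> F \<Longrightarrow> emp_risk \<phi> n D (f n D) \<le> emp_risk \<phi> n D g"
    if "D \<in> space (sample_space X n)" for D g
    using f(2) n that unfolding ERM_def by (auto simp: is_arg_min_linorder)
  have f1: "\<bar>f n D x\<bar> \<le> 1" if "D \<in> space (sample_space X n)" "x \<in> space X" for D x
    using FD(5)[OF fF] that by blast
  have ir: "integrable ?P (\<lambda>D. real_risk \<phi> \<pi> (f n D))"
    using f(1) n by (intro integrable_real_risk[OF \<pi> \<phi> B' _ f1]) (auto simp: statistic_def)
  show "expected_excess_risk \<phi> X \<pi> f n \<le> (MIN g\<in>F. excess_risk \<phi> X \<pi> g) + ereal (B * sqrt (ln M / (2 * real n)))"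
  proof (rule expected_excess_risk_le[OF \<pi> \<phi> B' _ F M1 f(1) n f1])
    show "- 0 \<le> \<phi> t" for t using pos by simp
    fix g assume g: "g \<in> F"
    have ig: "integrable \<pi> (\<lambda>z. \<phi> (snd z * g (fst z)))"
      by (rule integrable_bounded_loss[OF \<pi> \<phi> B' FD(4,5)[OF g]])
    note e = emp_risk_integral[OF \<pi> ig n order_refl]
    have "(\<integral>D. real_risk \<phi> \<pi> (f n D) \<partial>?P) - real_risk \<phi> \<pi> g
        = (\<integral>D. real_risk \<phi> \<pi> (f n D) - emp_risk \<phi> n D g \<partial>?P)"
      using ir e by simp
    also have "\<dots> \<le> B * sqrt (ln M / (2 * real n))"
    proof (rule expectation_max_deviation_le[OF \<pi> \<phi> B F M n order_refl])
      show "integrable ?P (\<lambda>D. real_risk \<phi> \<pi> (f n D) - emp_risk \<phi> n D g)" using ir e by simp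
      show "\<exists>g'\<in>F. real_risk \<phi> \<pi> (f n D) - emp_risk \<phi> n D g \<le> real_risk \<phi> \<pi> g' - emp_risk \<phi> n D g'"
        if "D \<in> space (sample_space X n)" for D
        using opt[OF that g] fF[OF that] by (intro bexI[of _ "f n D"]) auto
    qed
    finally show "(\<integral>D. real_risk \<phi> \<pi> (f n D) \<partial>?P) \<le> real_risk \<phi> \<pi> g + B * sqrt (ln M / (2 * real n))" by simp
  qed
qed

section \<open>Exponential weights for convex losses\<close>

lemma exp_weight_nonneg: "exp_weight \<phi> \<beta> F k D f \<ge> 0"
  unfolding exp_weight_def by (intro divide_nonneg_nonneg sum_nonneg) auto

lemma exp_weight_sum:
  assumes "finite F" "F \<noteq> {}"
  shows "(\<Sum>f\<in>F. exp_weight \<phi> \<beta> F k D f) = 1"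
proof -
  have "(\<Sum>g\<in>F. exp (- (inverse \<beta> * real k * emp_risk \<phi> k D g))) > 0"
    using assms by (intro sum_pos) auto
  then show ?thesis unfolding exp_weight_def by (simp add: sum_divide_distrib[symmetric])
qed

lemma convex_combination_bounded:
  assumes "finite I" "\<And>i. i \<in> I \<Longrightarrow> w i \<ge> 0" "(\<Sum>i\<in>I. w i) = 1" "\<And>i. i \<in> I \<Longrightarrow> \<bar>u i\<bar> \<le> 1"
  shows "\<bar>\<Sum>i\<in>I. w i * u i\<bar> \<le> (1::real)"
proof -
  have "\<bar>\<Sum>i\<in>I. w i * u i\<bar> \<le> (\<Sum>i\<in>I. \<bar>w i * u i\<bar>)" by (rule sum_abs)
  also have "\<dots> \<le> (\<Sum>i\<in>I. w i)"
    using assms(2,4) by (intro sum_mono) (auto simp: abs_mult intro: mult_left_le)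
  finally show ?thesis using assms(3) by simp
qed

lemma exp_aggregate_bounded:
  assumes "F \<in> dictionaries X M" "M \<ge> 1" "x \<in> space X"
  shows "\<bar>exp_aggregate \<phi> \<beta> F k D x\<bar> \<le> 1"
proof -
  note FD = dictionariesD[OF assms(1,2)]
  show ?thesis unfolding exp_aggregate_def using FD assms(3)
    by (intro convex_combination_bounded exp_weight_sum exp_weight_nonneg) auto
qed

lemma exp_weight_measurable:
  fixes \<phi> :: "real \<Rightarrow> real"
  assumes \<phi>: "\<phi> \<in> borel_measurable borel" and F: "F \<in> dictionaries X M" "M \<ge> 1"
    and "f \<in> F" "k \<le> n"
  shows "(\<lambda>D. exp_weight \<phi> \<beta> F k D f) \<in> borel_measurable (sample_space X n)"
proof -
  note FD = dictionariesD[OF F]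
  have [measurable]: "(\<lambda>D. emp_risk \<phi> k D g) \<in> borel_measurable (sample_space X n)" if "g \<in> F" for g
    using emp_risk_measurable[OF \<phi> FD(4)[OF that] assms(5)] .
  show ?thesis unfolding exp_weight_def using assms(4) by measurable
qed

lemma exp_aggregate_measurable:
  fixes \<phi> :: "real \<Rightarrow> real"
  assumes \<phi>: "\<phi> \<in> borel_measurable borel" and F: "F \<in> dictionaries X M" "M \<ge> 1" and "k \<le> n"
  shows "(\<lambda>(D, x). exp_aggregate \<phi> \<beta> F k D x) \<in> borel_measurable (sample_space X n \<Otimes>\<^sub>M X)"
proof -
  note FD = dictionariesD[OF F]
  have "(\<lambda>p. exp_weight \<phi> \<beta> F k (fst p) f * f (snd p)) \<in> borel_measurable (sample_space X n \<Otimes>\<^sub>M X)"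
    if "f \<in> F" for f
    using measurable_compose[OF measurable_fst exp_weight_measurable[OF \<phi> F that assms(4)]]
      measurable_compose[OF measurable_snd FD(4)[OF that]]
    by (intro borel_measurable_times)
  then show ?thesis unfolding exp_aggregate_def case_prod_unfold by (intro borel_measurable_sum)
qed

text \<open>Jensen's inequality, applied pointwise. The index set is general because it is used both
  for the exponential weights on \<open>F\<close> and for the uniform weights 1 / n of CAEW.\<close>

lemma real_risk_convex:
  fixes \<phi> :: "real \<Rightarrow> real"
  assumes \<pi>: "\<pi> \<in> pair_distributions X" and \<phi>: "\<phi> \<in> borel_measurable borel"
    and B: "\<And>t. t \<in> {-1..1} \<Longrightarrow> \<bar>\<phi> t\<bar> \<le> B" and conv: "convex_on {-1..1} \<phi>"
    and I: "finite I" "\<And>i. i \<in> I \<Longrightarrow> w i \<ge> 0" "(\<Sum>i\<in>I. w i) = 1"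
    and f: "\<And>i. i \<in> I \<Longrightarrow> f i \<in> borel_measurable X" "\<And>i x. i \<in> I \<Longrightarrow> x \<in> space X \<Longrightarrow> \<bar>f i x\<bar> \<le> 1"
  shows "real_risk \<phi> \<pi> (\<lambda>x. \<Sum>i\<in>I. w i * f i x) \<le> (\<Sum>i\<in>I. w i * real_risk \<phi> \<pi> (f i))"
proof -
  note D = pair_distributionsD[OF \<pi>]
  have int: "integrable \<pi> (\<lambda>z. \<phi> (snd z * f i (fst z)))" if "i \<in> I" for i
    by (rule integrable_bounded_loss[OF \<pi> \<phi> B f[OF that]])
  have "real_risk \<phi> \<pi> (\<lambda>x. \<Sum>i\<in>I. w i * f i x) \<le> (\<integral>z. (\<Sum>i\<in>I. w i * \<phi> (snd z * f i (fst z))) \<partial>\<pi>)"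
    unfolding real_risk_def
  proof (rule integral_mono)
    show "integrable \<pi> (\<lambda>z. \<phi> (snd z * (\<Sum>i\<in>I. w i * f i (fst z))))"
      by (rule integrable_bounded_loss[OF \<pi> \<phi> B]) (use f I in \<open>auto intro!: convex_combination_bounded\<close>)
    show "integrable \<pi> (\<lambda>z. \<Sum>i\<in>I. w i * \<phi> (snd z * f i (fst z)))"
      using int by (intro Bochner_Integration.integrable_sum integrable_mult_right) auto
    fix z assume "z \<in> space \<pi>"
    then have z: "snd z \<in> {-1, 1}" "fst z \<in> space X" by (auto simp: D(3))
    have "snd z * (\<Sum>i\<in>I. w i * f i (fst z)) = (\<Sum>i\<in>I. w i *\<^sub>R (snd z * f i (fst z)))"
      by (simp add: sum_distrib_left mult_ac)
    also have "\<phi> \<dots> \<le> (\<Sum>i\<in>I. w i * \<phi> (snd z * f i (fst z)))"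
    proof (rule convex_on_sum[OF I(1) _ conv I(3) I(2)])
      show "I \<noteq> {}" using I(3) by auto
      show "snd z * f i (fst z) \<in> {-1..1}" if "i \<in> I" for i
        using f(2)[OF that z(2)] z(1) by (intro label_times_bounded)
    qed
    finally show "\<phi> (snd z * (\<Sum>i\<in>I. w i * f i (fst z))) \<le> (\<Sum>i\<in>I. w i * \<phi> (snd z * f i (fst z)))" .
  qed
  also have "\<dots> = (\<Sum>i\<in>I. w i * real_risk \<phi> \<pi> (f i))"
    unfolding real_risk_def using int
    by (subst Bochner_Integration.integral_sum) (auto intro!: integrable_mult_right)
  finally show ?thesis .
qed

section \<open>Gibbs weights and the risk of a single aggregate\<close>

text \<open>The mean energy under the Gibbs weights is at most ln (card F) - ln Z, and -ln Z \<le> a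
  g because \<open>Z\<close> contains the term of \<open>g\<close>. The first bound is the
  nonnegativity of a relative entropy, obtained here from a tangent line to exp.\<close>

lemma gibbs_mean_le:
  fixes a :: "'b \<Rightarrow> real"
  assumes F: "finite F" "g \<in> F"
  defines "Z \<equiv> \<Sum>f\<in>F. exp (- a f)"
  shows "(\<Sum>f\<in>F. exp (- a f) / Z * a f) \<le> a g + ln (card F)"
proof -
  have Zg: "exp (- a g) \<le> Z" unfolding Z_def using F by (intro member_le_sum) auto
  have Z: "Z > 0" using Zg exp_gt_zero[of "- a g"] by linarith
  have c: "card F > 0" using F by (auto simp: card_gt_0_iff)
  \<comment> \<open>The tangent point for which the exponential terms sum to 1, so that the bound
    becomes 1 + (u - 1) = u.\<close>
  define u where "u = ln (card F / Z)"
  have w: "(\<Sum>f\<in>F. exp (- a f) / Z) = 1" using Z by (simp add: Z_def sum_divide_distrib[symmetric])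
  have eu: "exp (- u) = Z / card F" using Z c by (simp add: u_def exp_minus)
  have "(\<Sum>f\<in>F. exp (- a f) / Z * a f) \<le> (\<Sum>f\<in>F. exp (- a f) / Z * (exp (a f - u) + (u - 1)))"
  proof (intro sum_mono mult_left_mono)
    show "a f \<le> exp (a f - u) + (u - 1)" for f using exp_ge_add_one_self[of "a f - u"] by linarith
  qed (use Z in auto)
  also have "\<dots> = (\<Sum>f\<in>F. exp (- u) / Z) + (u - 1) * (\<Sum>f\<in>F. exp (- a f) / Z)"
  proof -
    have e: "exp (- a f) * exp (a f - u) = exp (- u)" for f by (simp flip: exp_add)
    have "exp (- a f) / Z * (exp (a f - u) + (u - 1))
        = (exp (- a f) * exp (a f - u)) / Z + (u - 1) * (exp (- a f) / Z)" for f
      by (simp add: distrib_left mult.commute)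
    then have "exp (- a f) / Z * (exp (a f - u) + (u - 1)) = exp (- u) / Z + (u - 1) * (exp (- a f) / Z)" for f
      unfolding e .
    then show ?thesis by (simp add: sum.distrib sum_distrib_left)
  qed
  also have "\<dots> = u" using Z c by (simp add: w eu)
  finally have "(\<Sum>f\<in>F. exp (- a f) / Z * a f) \<le> ln (card F) - ln Z" using Z c by (simp add: u_def ln_div)
  moreover have "- ln Z \<le> a g" using Zg Z by (metis ln_exp ln_le_cancel_iff exp_gt_zero neg_le_iff_le minus_minus)
  ultimately show ?thesis by simp
qed

lemma exp_weight_emp_risk_le:
  assumes F: "F \<in> dictionaries X M" "M \<ge> 1" and g: "g \<in> F" and k: "k \<ge> 1"
  shows "(\<Sum>f\<in>F. exp_weight \<phi> 1 F k D f * emp_risk \<phi> k D f) \<le> emp_risk \<phi> k D g + ln M / k"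
proof -
  note FD = dictionariesD[OF F]
  have "(\<Sum>f\<in>F. exp_weight \<phi> 1 F k D f * (k * emp_risk \<phi> k D f)) \<le> k * emp_risk \<phi> k D g + ln M"
    using gibbs_mean_le[OF FD(1) g, of "\<lambda>f. k * emp_risk \<phi> k D f"] FD(3) by (simp add: exp_weight_def)
  moreover have "(\<Sum>f\<in>F. exp_weight \<phi> 1 F k D f * (k * emp_risk \<phi> k D f))
     = k * (\<Sum>f\<in>F. exp_weight \<phi> 1 F k D f * emp_risk \<phi> k D f)"
    by (simp add: sum_distrib_left mult_ac)
  ultimately show ?thesis using k by (simp add: field_simps)
qed

text \<open>Exponential weighting loses at most \<open>ln M / k\<close> in empirical risk, and
  trivially at most 2. For small \<open>k\<close> the first quantity exceeds the square root rate;
  the truncation at 2 restores it.\<close>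

lemma min_le_sqrt:
  assumes "0 \<le> (x::real)"
  shows "min 2 x \<le> 2 * sqrt x"
proof (cases "x \<le> 1")
  case True
  then have "x \<le> sqrt x" using assms by (intro real_le_rsqrt) (simp add: power2_eq_square mult_left_le)
  then show ?thesis using assms by (simp add: min_def)
next
  case False
  then have "2 \<le> 2 * sqrt x" by simp
  then show ?thesis by (rule min.coboundedI1)
qed

text \<open>By convexity the risk is at most the weighted mean of the risks; passing to empirical
  risks costs a weighted mean of deviations. The constant 4 is 2 from the deviations, where
  \<open>B\<close> is 2 and the factor 1 / sqrt 2 is dropped, plus 2 from
  \<open>min_le_sqrt\<close>.\<close>

lemma exp_aggregate_risk_le:
  fixes \<phi> :: "real \<Rightarrow> real"
  assumes \<pi>: "\<pi> \<in> pair_distributions X" and \<phi>: "\<phi> \<in> borel_measurable borel"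
    and B: "\<And>t. t \<in> {-1..1} \<Longrightarrow> \<phi> t \<in> {0..2}" and conv: "convex_on {-1..1} \<phi>"
    and F: "F \<in> dictionaries X M" "M \<ge> 2" and k: "1 \<le> k" "k \<le> n" and g: "g \<in> F"
  shows "(\<integral>D. real_risk \<phi> \<pi> (exp_aggregate \<phi> 1 F k D) \<partial>PiM {1..n} (\<lambda>_. \<pi>))
    \<le> real_risk \<phi> \<pi> g + 4 * sqrt (ln M / k)"
proof -
  let ?P = "PiM {1..n} (\<lambda>_. \<pi>)"
  note D = pair_distributionsD[OF \<pi>]
  interpret P: prob_space ?P by (intro prob_space_sample D)
  have M1: "M \<ge> 1" using F by simp
  note FD = dictionariesD[OF F(1) M1]
  have B': "\<bar>\<phi> t\<bar> \<le> 2" if "t \<in> {-1..1}" for t using B[OF that] by auto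
  let ?x = "ln M / k" and ?R = "real_risk \<phi> \<pi>" and ?f = "exp_aggregate \<phi> 1 F k"
    and ?w = "exp_weight \<phi> 1 F k"
  have x: "?x \<ge> 0" using F k by simp
  have iR: "integrable ?P (\<lambda>D. ?R (?f D))"
    by (intro integrable_real_risk[OF \<pi> \<phi> B'] exp_aggregate_measurable[OF \<phi> F(1) M1 k(2)]
        exp_aggregate_bounded[OF F(1) M1])
  have ig: "integrable \<pi> (\<lambda>z. \<phi> (snd z * g (fst z)))"
    by (rule integrable_bounded_loss[OF \<pi> \<phi> B' FD(4,5)[OF g]])
  note e = emp_risk_integral[OF \<pi> ig k]
  let ?W = "\<lambda>D. ?R (?f D) - emp_risk \<phi> k D g - min 2 ?x"
  have iW: "integrable ?P ?W" using iR e by simp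
  have "(\<integral>D. ?W D \<partial>?P) \<le> 2 * sqrt (ln M / (2 * real k))"
  proof (rule expectation_max_deviation_le[OF \<pi> \<phi> B _ F k iW])
    fix D assume D: "D \<in> space (sample_space X n)"
    have s1: "(\<Sum>f\<in>F. ?w D f) = 1" using FD by (intro exp_weight_sum)
    have "?R (?f D) \<le> (\<Sum>f\<in>F. ?w D f * ?R f)" unfolding exp_aggregate_def
      by (intro real_risk_convex[OF \<pi> \<phi> B' conv FD(1)] exp_weight_nonneg s1 FD)
    moreover have "(\<Sum>f\<in>F. ?w D f * emp_risk \<phi> k D f) \<le> emp_risk \<phi> k D g + min 2 ?x"
    proof -
      have eb: "emp_risk \<phi> k D f \<in> {0..2}" if "f \<in> F" for f
        by (rule emp_risk_bounds[OF B D k(2) FD(5)[OF that]]) auto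
      have "(\<Sum>f\<in>F. ?w D f * emp_risk \<phi> k D f) \<le> (\<Sum>f\<in>F. ?w D f * 2)"
        using eb by (intro sum_mono mult_left_mono exp_weight_nonneg) auto
      also have "\<dots> = 2" using s1 by (simp add: sum_distrib_right[symmetric])
      finally have "(\<Sum>f\<in>F. ?w D f * emp_risk \<phi> k D f) \<le> emp_risk \<phi> k D g + 2"
        using eb[OF g] by auto
      with exp_weight_emp_risk_le[OF F(1) M1 g k(1), of \<phi> D] show ?thesis by simp
    qed
    ultimately have le: "?W D \<le> (\<Sum>f\<in>F. ?w D f * (?R f - emp_risk \<phi> k D f))"
      by (simp add: right_diff_distrib sum_subtractf)
    \<comment> \<open>A number that exceeds every deviation also exceeds their weighted
      mean.\<close>
    show "\<exists>f\<in>F. ?W D \<le> ?R f - emp_risk \<phi> k D f"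
    proof (rule ccontr)
      assume "\<not> ?thesis"
      then have lt: "?R f - emp_risk \<phi> k D f < ?W D" if "f \<in> F" for f using that by force
      have "(\<Sum>f\<in>F. ?w D f * (?R f - emp_risk \<phi> k D f)) < (\<Sum>f\<in>F. ?w D f * ?W D)"
      proof (intro sum_strict_mono mult_strict_left_mono lt FD)
        show "?w D f > 0" if "f \<in> F" for f unfolding exp_weight_def
          using FD by (intro divide_pos_pos sum_pos) auto
      qed
      also have "\<dots> = ?W D" using s1 by (simp only: sum_distrib_right[symmetric] mult_1)
      finally show False using le by simp
    qed
  qed simp_all
  moreover have "(\<integral>D. ?W D \<partial>?P) = (\<integral>D. ?R (?f D) \<partial>?P) - ?R g - min 2 ?x"
    using iR e by (simp add: P.prob_space)
  moreover have "sqrt (ln M / (2 * real k)) \<le> sqrt ?x"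
    using F k by (intro real_sqrt_le_mono divide_left_mono) auto
  ultimately show ?thesis using min_le_sqrt[OF x] by linarith
qed

section \<open>Averaging the aggregates over the sample sizes\<close>

lemma CAEW_statistic:
  fixes \<phi> :: "real \<Rightarrow> real"
  assumes \<phi>: "\<phi> \<in> borel_measurable borel" and F: "F \<in> dictionaries X M" "M \<ge> 1"
  shows "statistic X (\<lambda>n D x. (1 / real n) * (\<Sum>k=1..n. exp_aggregate \<phi> \<beta> F k D x))"
  unfolding statistic_def
proof (intro allI impI)
  fix n :: nat
  have "(\<lambda>p. exp_aggregate \<phi> \<beta> F k (fst p) (snd p)) \<in> borel_measurable (sample_space X n \<Otimes>\<^sub>M X)"
    if "k \<in> {1..n}" for k
    using exp_aggregate_measurable[OF \<phi> F, of k n \<beta>] that by (simp add: case_prod_unfold)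
  then show "(\<lambda>(D, x). (1 / real n) * (\<Sum>k=1..n. exp_aggregate \<phi> \<beta> F k D x))
      \<in> borel_measurable (sample_space X n \<Otimes>\<^sub>M X)"
    unfolding case_prod_unfold by (intro borel_measurable_times borel_measurable_sum) auto
qed

lemma CAEW_bounded:
  assumes F: "F \<in> dictionaries X M" "M \<ge> 1" and "n \<ge> 1" "x \<in> space X"
  shows "\<bar>(1 / real n) * (\<Sum>k=1..n. exp_aggregate \<phi> \<beta> F k D x)\<bar> \<le> 1"
  unfolding sum_distrib_left using assms
  by (intro convex_combination_bounded exp_aggregate_bounded[OF F]) auto

lemma CAEW_risk_le:
  fixes \<phi> :: "real \<Rightarrow> real"
  assumes \<pi>: "\<pi> \<in> pair_distributions X" and \<phi>: "\<phi> \<in> borel_measurable borel"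
    and B: "\<And>t. t \<in> {-1..1} \<Longrightarrow> \<bar>\<phi> t\<bar> \<le> B" and conv: "convex_on {-1..1} \<phi>"
    and F: "F \<in> dictionaries X M" "M \<ge> 1" and n: "n \<ge> 1"
  defines "P \<equiv> PiM {1..n} (\<lambda>_. \<pi>)"
  shows "(\<integral>D. real_risk \<phi> \<pi> (\<lambda>x. (1 / real n) * (\<Sum>k=1..n. exp_aggregate \<phi> \<beta> F k D x)) \<partial>P)
    \<le> (1 / real n) * (\<Sum>k=1..n. \<integral>D. real_risk \<phi> \<pi> (exp_aggregate \<phi> \<beta> F k D) \<partial>P)"
proof -
  have iR: "integrable P (\<lambda>D. real_risk \<phi> \<pi> (exp_aggregate \<phi> \<beta> F k D))" if "k \<in> {1..n}" for k
    unfolding P_def using that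
    by (intro integrable_real_risk[OF \<pi> \<phi> B] exp_aggregate_measurable[OF \<phi> F] exp_aggregate_bounded[OF F])
       auto
  have "(\<integral>D. real_risk \<phi> \<pi> (\<lambda>x. (1 / real n) * (\<Sum>k=1..n. exp_aggregate \<phi> \<beta> F k D x)) \<partial>P)
    \<le> (\<integral>D. (\<Sum>k=1..n. (1 / real n) * real_risk \<phi> \<pi> (exp_aggregate \<phi> \<beta> F k D)) \<partial>P)"
  proof (rule integral_mono)
    show "integrable P (\<lambda>D. real_risk \<phi> \<pi> (\<lambda>x. (1 / real n) * (\<Sum>k=1..n. exp_aggregate \<phi> \<beta> F k D x)))"
      unfolding P_def using CAEW_statistic[OF \<phi> F, of \<beta>] n
      by (intro integrable_real_risk[OF \<pi> \<phi> B] CAEW_bounded[OF F n]) (auto simp: statistic_def)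
    show "integrable P (\<lambda>D. \<Sum>k=1..n. (1 / real n) * real_risk \<phi> \<pi> (exp_aggregate \<phi> \<beta> F k D))"
      using iR by (intro Bochner_Integration.integrable_sum integrable_mult_right)
    fix D assume "D \<in> space P"
    then have D: "D \<in> space (sample_space X n)" unfolding P_def by (simp only: space_sample[OF \<pi>])
    show "real_risk \<phi> \<pi> (\<lambda>x. (1 / real n) * (\<Sum>k=1..n. exp_aggregate \<phi> \<beta> F k D x))
      \<le> (\<Sum>k=1..n. (1 / real n) * real_risk \<phi> \<pi> (exp_aggregate \<phi> \<beta> F k D))"
      unfolding sum_distrib_left
    proof (rule real_risk_convex[OF \<pi> \<phi> B conv])
      show "exp_aggregate \<phi> \<beta> F k D \<in> borel_measurable X" if "k \<in> {1..n}" for k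
        using measurable_Pair2[OF exp_aggregate_measurable[OF \<phi> F, of k n \<beta>] D] that by simp
      show "\<bar>exp_aggregate \<phi> \<beta> F k D x\<bar> \<le> 1" if "x \<in> space X" for k x
        using exp_aggregate_bounded[OF F that] .
    qed (use n in auto)
  qed
  also have "\<dots> = (1 / real n) * (\<Sum>k=1..n. \<integral>D. real_risk \<phi> \<pi> (exp_aggregate \<phi> \<beta> F k D) \<partial>P)"
    using iR by (subst Bochner_Integration.integral_sum) (auto simp: sum_distrib_left intro!: integrable_mult_right)
  finally show ?thesis .
qed

lemma upper_bound_AEW:
  fixes \<phi> :: "real \<Rightarrow> real"
  assumes \<phi>: "\<phi> \<in> borel_measurable borel"
    and B: "\<And>t. t \<in> {-1..1} \<Longrightarrow> \<phi> t \<in> {0..2}" and conv: "convex_on {-1..1} \<phi>"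
    and pos: "\<And>t. \<phi> t \<ge> 0" and M: "M \<ge> 2"
  shows "upper_bound_by X M \<phi> (AEW \<phi>) (\<lambda>n. 4 * sqrt (ln M / real n))"
  unfolding upper_bound_by_def AEW_def
proof (intro ballI conjI allI impI; (elim conjE)?)
  fix F assume F: "F \<in> dictionaries X M"
  have M1: "M \<ge> 1" using M by simp
  have B': "\<bar>\<phi> t\<bar> \<le> 2" if "t \<in> {-1..1}" for t using B[OF that] by auto
  have st: "statistic X (exp_aggregate \<phi> 1 F)"
    unfolding statistic_def using exp_aggregate_measurable[OF \<phi> F M1] by simp
  then show "\<exists>f. statistic X f \<and> f = exp_aggregate \<phi> 1 F" by simp
  fix f \<pi> and n :: nat assume f: "f = exp_aggregate \<phi> 1 F" and \<pi>: "\<pi> \<in> pair_distributions X" and n: "n \<ge> 1"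
  show "expected_excess_risk \<phi> X \<pi> f n \<le> (MIN g\<in>F. excess_risk \<phi> X \<pi> g) + ereal (4 * sqrt (ln M / real n))"
    unfolding f
    by (rule expected_excess_risk_le[OF \<pi> \<phi> B' _ F M1 st n exp_aggregate_bounded[OF F M1]
          exp_aggregate_risk_le[OF \<pi> \<phi> B conv F M n order_refl], where K = 0])
       (use pos in auto)
qed

lemma sum_inverse_sqrt_le: "(\<Sum>k=1..n. 1 / sqrt (real k)) \<le> 2 * sqrt (real n)"
proof (induction n)
  case (Suc n)
  define a b where "a = sqrt (real n)" and "b = sqrt (real (Suc n))"
  have b: "b > 0" "b\<^sup>2 = a\<^sup>2 + 1" "a \<ge> 0" by (simp_all add: a_def b_def)
  \<comment> \<open>The inductive step is 1 / b \<le> 2 (b - a); multiplied by b, it is this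
    inequality with \<open>b\<^sup>2 = a\<^sup>2 + 1\<close>.\<close>
  have "2 * a * b \<le> a\<^sup>2 + b\<^sup>2" using sum_squares_bound[of a b] by simp
  then have "2 * a * b + 1 \<le> 2 * b * b" using b(2) by (simp add: power2_eq_square)
  then have "2 * a + 1 / b \<le> 2 * b" using b(1) by (simp add: field_simps)
  then show ?case using Suc by (simp add: a_def b_def)
qed simp

lemma upper_bound_CAEW_hinge:
  fixes \<phi> :: "real \<Rightarrow> real"
  assumes \<phi>: "\<phi> \<in> borel_measurable borel"
    and B: "\<And>t. t \<in> {-1..1} \<Longrightarrow> \<phi> t \<in> {0..2}" and conv: "convex_on {-1..1} \<phi>"
    and pos: "\<And>t. \<phi> t \<ge> 0" and M: "M \<ge> 2"
  shows "upper_bound_by X M \<phi> (CAEW \<phi> 1) (\<lambda>n. 8 * sqrt (ln M / real n))"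
  unfolding upper_bound_by_def CAEW_def
proof (intro ballI conjI allI impI; (elim conjE)?)
  fix F assume F: "F \<in> dictionaries X M"
  have M1: "M \<ge> 1" using M by simp
  have B': "\<bar>\<phi> t\<bar> \<le> 2" if "t \<in> {-1..1}" for t using B[OF that] by auto
  let ?f = "\<lambda>n D x. (1 / real n) * (\<Sum>k=1..n. exp_aggregate \<phi> 1 F k D x)"
  have st: "statistic X ?f" by (rule CAEW_statistic[OF \<phi> F M1])
  then show "\<exists>f. statistic X f \<and> f = ?f" by blast
  fix f \<pi> and n :: nat assume f: "f = ?f" and \<pi>: "\<pi> \<in> pair_distributions X" and n: "n \<ge> 1"
  let ?P = "PiM {1..n} (\<lambda>_. \<pi>)"
  show "expected_excess_risk \<phi> X \<pi> f n \<le> (MIN g\<in>F. excess_risk \<phi> X \<pi> g) + ereal (8 * sqrt (ln M / real n))"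
    unfolding f
  proof (rule expected_excess_risk_le[OF \<pi> \<phi> B' _ F M1 st n CAEW_bounded[OF F M1 n], where K = 0])
    fix g assume g: "g \<in> F"
    let ?s = "sqrt (ln M)"
    have "(\<integral>D. real_risk \<phi> \<pi> (?f n D) \<partial>?P)
      \<le> (1 / real n) * (\<Sum>k=1..n. \<integral>D. real_risk \<phi> \<pi> (exp_aggregate \<phi> 1 F k D) \<partial>?P)"
      by (rule CAEW_risk_le[OF \<pi> \<phi> B' conv F M1 n])
    also have "\<dots> \<le> (1 / real n) * (\<Sum>k=1..n. real_risk \<phi> \<pi> g + 4 * ?s * (1 / sqrt (real k)))"
    proof (intro mult_left_mono sum_mono)
      fix k assume "k \<in> {1..n}"
      then show "(\<integral>D. real_risk \<phi> \<pi> (exp_aggregate \<phi> 1 F k D) \<partial>?P)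
          \<le> real_risk \<phi> \<pi> g + 4 * ?s * (1 / sqrt (real k))"
        using exp_aggregate_risk_le[OF \<pi> \<phi> B conv F M _ _ g, of k n] by (simp add: real_sqrt_divide)
    qed simp
    also have "\<dots> = real_risk \<phi> \<pi> g + (4 * ?s / n) * (\<Sum>k=1..n. 1 / sqrt (real k))"
      using n by (simp only: sum.distrib sum_distrib_left[symmetric]) (simp add: field_simps)
    also have "\<dots> \<le> real_risk \<phi> \<pi> g + (4 * ?s / n) * (2 * sqrt (real n))"
      using M by (intro add_left_mono mult_left_mono sum_inverse_sqrt_le) auto
    also have "(4 * ?s / n) * (2 * sqrt (real n)) = 8 * sqrt (ln M / real n)"
      using n by (simp add: real_sqrt_divide field_simps)
    finally show "(\<integral>D. real_risk \<phi> \<pi> (?f n D) \<partial>?P) \<le> real_risk \<phi> \<pi> g + 8 * sqrt (ln M / real n)" by simp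
  qed (use pos in auto)
qed

section \<open>Exponential weights for exp-concave losses\<close>

lemma scaled_emp_risk: "real k * emp_risk \<phi> k D g = (\<Sum>i=1..k. \<phi> (snd (D i) * g (fst (D i))))"
  by (cases "k = 0") (simp_all add: emp_risk_def)

lemma emp_risk_update: "i \<notin> {1..k} \<Longrightarrow> emp_risk \<phi> k (D(i := z)) g = emp_risk \<phi> k D g"
  unfolding emp_risk_def by (intro arg_cong2[where f = "(*)"] refl sum.cong) auto

text \<open>The \<open>k\<close>-th aggregate reads only the first \<open>k\<close> observations.
  This is the form in which its independence of the later ones enters Fubini's theorem.\<close>

lemma exp_aggregate_update:
  "i \<notin> {1..k} \<Longrightarrow> exp_aggregate \<phi> \<beta> F k (D(i := z)) = exp_aggregate \<phi> \<beta> F k D"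
  unfolding exp_aggregate_def exp_weight_def by (simp add: emp_risk_update)

text \<open>\<open>- \<beta> ln (\<Sum>g\<in>F. exp (- k A\<^sub>k(g) / \<beta>))\<close> is the potential of the telescoping argument.\<close>

lemma exp_aggregate_loss_le:
  fixes \<phi> :: "real \<Rightarrow> real"
  assumes conc: "concave_on {-1..1} (\<lambda>t. exp (- (inverse \<beta> * \<phi> t)))" and \<beta>: "\<beta> > 0"
    and F: "F \<in> dictionaries X M" "M \<ge> 1"
    and D: "D \<in> space (sample_space X n)" and k: "k < n"
  defines "Z \<equiv> \<lambda>k. \<Sum>g\<in>F. exp (- (inverse \<beta> * real k * emp_risk \<phi> k D g))"
  shows "\<phi> (snd (D (Suc k)) * exp_aggregate \<phi> \<beta> F k D (fst (D (Suc k))))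
    \<le> \<beta> * ln (Z k) - \<beta> * ln (Z (Suc k))"
proof -
  note FD = dictionariesD[OF F]
  define x y where "x = fst (D (Suc k))" and "y = snd (D (Suc k))"
  have xy: "x \<in> space X" "y \<in> {-1, 1}"
    using sample_space_component[OF D, of "Suc k"] k by (auto simp: x_def y_def)
  let ?w = "exp_weight \<phi> \<beta> F k D"
  have Z: "Z j > 0" for j unfolding Z_def using FD by (intro sum_pos) auto
  have "(\<Sum>g\<in>F. ?w g * exp (- (inverse \<beta> * \<phi> (y * g x))))
      \<le> exp (- (inverse \<beta> * \<phi> (\<Sum>g\<in>F. ?w g *\<^sub>R (y * g x))))"
    by (rule concave_on_sum[OF FD(1,2) conc exp_weight_sum[OF FD(1,2)] exp_weight_nonneg])
       (use label_times_bounded[OF xy(2) FD(5)[OF _ xy(1)]] in auto)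
  also have "(\<Sum>g\<in>F. ?w g *\<^sub>R (y * g x)) = y * exp_aggregate \<phi> \<beta> F k D x"
    by (simp add: exp_aggregate_def sum_distrib_left mult_ac)
  also have "(\<Sum>g\<in>F. ?w g * exp (- (inverse \<beta> * \<phi> (y * g x)))) = Z (Suc k) / Z k"
  proof -
    \<comment> \<open>The weight of round \<open>k\<close> times the factor of the new observation
      is the unnormalized weight of round \<open>Suc k\<close>.\<close>
    have e: "exp (- (inverse \<beta> * real k * emp_risk \<phi> k D g)) * exp (- (inverse \<beta> * \<phi> (y * g x)))
      = exp (- (inverse \<beta> * real (Suc k) * emp_risk \<phi> (Suc k) D g))" for g
      unfolding mult.assoc scaled_emp_risk
      by (simp add: x_def y_def exp_add[symmetric] distrib_left)
    show ?thesis unfolding exp_weight_def Z_def times_divide_eq_left e by (rule sum_divide_distrib[symmetric])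
  qed
  finally have "ln (Z (Suc k) / Z k) \<le> - (inverse \<beta> * \<phi> (y * exp_aggregate \<phi> \<beta> F k D x))"
    using Z by (metis divide_pos_pos exp_gt_zero ln_exp ln_le_cancel_iff)
  then have "ln (Z (Suc k)) - ln (Z k) \<le> - (inverse \<beta> * \<phi> (y * exp_aggregate \<phi> \<beta> F k D x))"
    using Z by (simp add: ln_divide_pos)
  then have "\<beta> * (ln (Z (Suc k)) - ln (Z k)) \<le> \<beta> * - (inverse \<beta> * \<phi> (y * exp_aggregate \<phi> \<beta> F k D x))"
    using \<beta> by (intro mult_left_mono) auto
  then show ?thesis using \<beta> by (simp add: x_def y_def right_diff_distrib mult.assoc[symmetric])
qed

text \<open>The one-step bounds telescope. The initial potential comes from uniform weights, and the
  final partition function is at least its single term for \<open>g\<close>.\<close>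

lemma exp_aggregate_cumulative_loss_le:
  fixes \<phi> :: "real \<Rightarrow> real"
  assumes conc: "concave_on {-1..1} (\<lambda>t. exp (- (inverse \<beta> * \<phi> t)))" and \<beta>: "\<beta> > 0"
    and F: "F \<in> dictionaries X M" "M \<ge> 1"
    and D: "D \<in> space (sample_space X n)" and g: "g \<in> F"
  shows "(\<Sum>k<n. \<phi> (snd (D (Suc k)) * exp_aggregate \<phi> \<beta> F k D (fst (D (Suc k)))))
    \<le> real n * emp_risk \<phi> n D g + \<beta> * ln M"
proof -
  note FD = dictionariesD[OF F]
  define Z where "Z = (\<lambda>k. \<Sum>g\<in>F. exp (- (inverse \<beta> * real k * emp_risk \<phi> k D g)))"
  have "(\<Sum>k<n. \<phi> (snd (D (Suc k)) * exp_aggregate \<phi> \<beta> F k D (fst (D (Suc k)))))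
      \<le> (\<Sum>k<n. \<beta> * ln (Z k) - \<beta> * ln (Z (Suc k)))"
    unfolding Z_def by (intro sum_mono exp_aggregate_loss_le[OF conc \<beta> F D]) auto
  also have "\<dots> = \<beta> * ln (Z 0) - \<beta> * ln (Z n)" by (rule sum_lessThan_telescope')
  also have "Z 0 = M" using FD by (simp add: Z_def)
  also have "- (inverse \<beta> * (real n * emp_risk \<phi> n D g)) \<le> ln (Z n)"
  proof -
    have "exp (- (inverse \<beta> * real n * emp_risk \<phi> n D g)) \<le> Z n"
      unfolding Z_def using FD(1) g by (intro member_le_sum) auto
    then have "ln (exp (- (inverse \<beta> * real n * emp_risk \<phi> n D g))) \<le> ln (Z n)"
      by (subst ln_le_cancel_iff) (auto intro: less_le_trans[OF exp_gt_zero])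
    then show ?thesis by (simp add: mult.assoc)
  qed
  then have "\<beta> * - (inverse \<beta> * (real n * emp_risk \<phi> n D g)) \<le> \<beta> * ln (Z n)"
    using \<beta> by (intro mult_left_mono) auto
  ultimately show ?thesis using \<beta> by (simp add: mult.assoc[symmetric])
qed

text \<open>Observation \<open>Suc k\<close> is independent of the \<open>k\<close>-th aggregate, so
  integrating it out first turns the loss into a risk. The sample has size \<open>Suc n\<close> so
  that the aggregate with k = n also meets a fresh observation.\<close>

lemma fresh_observation_risk:
  fixes \<phi> :: "real \<Rightarrow> real" and \<beta> :: real
  assumes \<pi>: "\<pi> \<in> pair_distributions X" and \<phi>: "\<phi> \<in> borel_measurable borel"
    and B: "\<And>t. t \<in> {-1..1} \<Longrightarrow> \<bar>\<phi> t\<bar> \<le> B" and F: "F \<in> dictionaries X M" "M \<ge> 1" and k: "k \<le> n"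
  defines "l \<equiv> \<lambda>D. \<phi> (snd (D (Suc k)) * exp_aggregate \<phi> \<beta> F k D (fst (D (Suc k))))"
  shows "integrable (PiM {1..Suc n} (\<lambda>_. \<pi>)) l"
    and "(\<integral>D. l D \<partial>PiM {1..Suc n} (\<lambda>_. \<pi>))
       = (\<integral>D. real_risk \<phi> \<pi> (exp_aggregate \<phi> \<beta> F k D) \<partial>PiM {1..n} (\<lambda>_. \<pi>))"
proof -
  note D = pair_distributionsD[OF \<pi>]
  interpret prob_space \<pi> by (rule D)
  interpret product_sigma_finite "\<lambda>_::nat. \<pi>" ..
  let ?P = "PiM {1..Suc n} (\<lambda>_. \<pi>)" and ?S = "sample_space X (Suc n)"
  let ?f = "exp_aggregate \<phi> \<beta> F k" and ?I = "{1..Suc n} - {Suc k}"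
  let ?R = "\<lambda>D. real_risk \<phi> \<pi> (?f D)"
  interpret P: prob_space ?P by (intro prob_space_sample D)
  have fm: "(\<lambda>(D, x). ?f D x) \<in> borel_measurable (?S \<Otimes>\<^sub>M X)"
    using k by (intro exp_aggregate_measurable[OF \<phi> F]) auto
  have [measurable]: "(\<lambda>D. D (Suc k)) \<in> ?S \<rightarrow>\<^sub>M obs_space X"
    unfolding sample_space_def using k by (intro measurable_component_singleton) auto
  have "(\<lambda>D. (D, fst (D (Suc k)))) \<in> ?S \<rightarrow>\<^sub>M ?S \<Otimes>\<^sub>M X" by measurable
  from measurable_compose[OF this fm]
  have [measurable]: "(\<lambda>D. ?f D (fst (D (Suc k)))) \<in> borel_measurable ?S" by simp
  have "l \<in> borel_measurable ?S" unfolding l_def using \<phi> by measurable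
  then have lm: "l \<in> borel_measurable ?P" by (simp only: measurable_cong_sets[OF sets_sample[OF \<pi>] refl])
  show il: "integrable ?P l"
  proof (rule P.integrable_const_bound[OF _ lm], rule AE_I2)
    fix D assume "D \<in> space ?P"
    then have "D \<in> space ?S" by (simp only: space_sample[OF \<pi>])
    from sample_space_component[OF this, of "Suc k"] k
    show "norm (l D) \<le> B" unfolding l_def real_norm_def
      by (intro B label_times_bounded exp_aggregate_bounded[OF F]) auto
  qed
  have iR: "integrable ?P ?R"
    by (rule integrable_real_risk[OF \<pi> \<phi> B fm exp_aggregate_bounded[OF F]])
  have ins: "insert (Suc k) ?I = {1..Suc n}" using k by auto
  have "(\<integral>D. l D \<partial>?P) = (\<integral>D. (\<integral>z. l (D(Suc k := z)) \<partial>\<pi>) \<partial>PiM ?I (\<lambda>_. \<pi>))"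
    using product_integral_insert[of ?I "Suc k" l] il unfolding ins by simp
  also have "\<dots> = (\<integral>D. ?R D \<partial>PiM ?I (\<lambda>_. \<pi>))"
    by (simp add: l_def exp_aggregate_update real_risk_def)
  \<comment> \<open>The removed coordinate is put back, since the aggregate does not read it;
    afterwards the last coordinate is dropped for the same reason.\<close>
  also have "\<dots> = (\<integral>D. (\<integral>z. ?R (D(Suc k := z)) \<partial>\<pi>) \<partial>PiM ?I (\<lambda>_. \<pi>))"
    by (simp add: exp_aggregate_update prob_space)
  also have "\<dots> = (\<integral>D. ?R D \<partial>?P)"
    using product_integral_insert[of ?I "Suc k" ?R] iR unfolding ins by simp
  also have "\<dots> = (\<integral>D. (\<integral>z. ?R (D(Suc n := z)) \<partial>\<pi>) \<partial>PiM {1..n} (\<lambda>_. \<pi>))"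
    using product_integral_insert[of "{1..n}" "Suc n" ?R] iR by (simp add: atLeastAtMostSuc_conv)
  also have "\<dots> = (\<integral>D. ?R D \<partial>PiM {1..n} (\<lambda>_. \<pi>))"
    using k by (simp add: exp_aggregate_update prob_space)
  finally show "(\<integral>D. l D \<partial>?P) = (\<integral>D. ?R D \<partial>PiM {1..n} (\<lambda>_. \<pi>))" .
qed

text \<open>Observation \<open>Suc n\<close> is virtual: it only serves as the next point for the
  aggregate k = n and disappears once expectations are taken.\<close>

lemma exp_aggregate_cumulative_risk_le:
  fixes \<phi> :: "real \<Rightarrow> real"
  assumes \<pi>: "\<pi> \<in> pair_distributions X" and \<phi>: "\<phi> \<in> borel_measurable borel"
    and B: "\<And>t. t \<in> {-1..1} \<Longrightarrow> \<bar>\<phi> t\<bar> \<le> B"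
    and conc: "concave_on {-1..1} (\<lambda>t. exp (- (inverse \<beta> * \<phi> t)))" and \<beta>: "\<beta> > 0"
    and F: "F \<in> dictionaries X M" "M \<ge> 1" and g: "g \<in> F"
  shows "(\<Sum>k<Suc n. \<integral>D. real_risk \<phi> \<pi> (exp_aggregate \<phi> \<beta> F k D) \<partial>PiM {1..n} (\<lambda>_. \<pi>))
    \<le> real (Suc n) * real_risk \<phi> \<pi> g + \<beta> * ln M"
proof -
  note D = pair_distributionsD[OF \<pi>] and FD = dictionariesD[OF F]
  let ?P = "PiM {1..Suc n} (\<lambda>_. \<pi>)"
  interpret P: prob_space ?P by (intro prob_space_sample D)
  let ?l = "\<lambda>k D. \<phi> (snd (D (Suc k)) * exp_aggregate \<phi> \<beta> F k D (fst (D (Suc k))))"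
  have fr: "integrable ?P (?l k)" "(\<integral>D. ?l k D \<partial>?P)
      = (\<integral>D. real_risk \<phi> \<pi> (exp_aggregate \<phi> \<beta> F k D) \<partial>PiM {1..n} (\<lambda>_. \<pi>))" if "k < Suc n" for k
    using fresh_observation_risk[OF \<pi> \<phi> B F, of k n \<beta>] that by auto
  have ig: "integrable \<pi> (\<lambda>z. \<phi> (snd z * g (fst z)))"
    by (rule integrable_bounded_loss[OF \<pi> \<phi> B FD(4,5)[OF g]])
  note e = emp_risk_integral[OF \<pi> ig _ order_refl, of "Suc n"]
  have "(\<Sum>k<Suc n. \<integral>D. real_risk \<phi> \<pi> (exp_aggregate \<phi> \<beta> F k D) \<partial>PiM {1..n} (\<lambda>_. \<pi>))
      = (\<integral>D. (\<Sum>k<Suc n. ?l k D) \<partial>?P)"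
    using fr by (subst Bochner_Integration.integral_sum) (auto intro!: sum.cong)
  also have "\<dots> \<le> (\<integral>D. real (Suc n) * emp_risk \<phi> (Suc n) D g + \<beta> * ln M \<partial>?P)"
  proof (rule integral_mono)
    show "integrable ?P (\<lambda>D. \<Sum>k<Suc n. ?l k D)" using fr by (intro Bochner_Integration.integrable_sum) auto
    show "integrable ?P (\<lambda>D. real (Suc n) * emp_risk \<phi> (Suc n) D g + \<beta> * ln M)"
      using e by (intro Bochner_Integration.integrable_add integrable_mult_right P.integrable_const) auto
    fix D assume "D \<in> space ?P"
    then have "D \<in> space (sample_space X (Suc n))" by (simp only: space_sample[OF \<pi>])
    then show "(\<Sum>k<Suc n. ?l k D) \<le> real (Suc n) * emp_risk \<phi> (Suc n) D g + \<beta> * ln M"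
      by (rule exp_aggregate_cumulative_loss_le[OF conc \<beta> F _ g])
  qed
  also have "\<dots> = real (Suc n) * real_risk \<phi> \<pi> g + \<beta> * ln M"
    using e by (subst Bochner_Integration.integral_add) (auto simp: P.prob_space intro!: integrable_mult_right)
  finally show ?thesis .
qed

lemma upper_bound_CAEW_exp_concave:
  fixes \<phi> :: "real \<Rightarrow> real"
  assumes \<phi>: "\<phi> \<in> borel_measurable borel"
    and B: "\<And>t. t \<in> {-1..1} \<Longrightarrow> \<bar>\<phi> t\<bar> \<le> B" and conv: "convex_on {-1..1} \<phi>"
    and conc: "concave_on {-1..1} (\<lambda>t. exp (- (inverse \<beta> * \<phi> t)))" and \<beta>: "\<beta> > 0"
    and K: "\<And>t. \<phi> t \<ge> - K" and M: "M \<ge> 2"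
  shows "upper_bound_by X M \<phi> (CAEW \<phi> \<beta>) (\<lambda>n. (\<beta> * ln M + 2 * B) / real n)"
  unfolding upper_bound_by_def CAEW_def
proof (intro ballI conjI allI impI; (elim conjE)?)
  fix F assume F: "F \<in> dictionaries X M"
  have M1: "M \<ge> 1" using M by simp
  note FD = dictionariesD[OF F M1]
  let ?f = "\<lambda>n D x. (1 / real n) * (\<Sum>k=1..n. exp_aggregate \<phi> \<beta> F k D x)"
  have st: "statistic X ?f" by (rule CAEW_statistic[OF \<phi> F M1])
  then show "\<exists>f. statistic X f \<and> f = ?f" by blast
  fix f \<pi> and n :: nat assume f: "f = ?f" and \<pi>: "\<pi> \<in> pair_distributions X" and n: "n \<ge> 1"
  note D = pair_distributionsD[OF \<pi>]
  let ?P = "PiM {1..n} (\<lambda>_. \<pi>)"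
  interpret P: prob_space ?P by (intro prob_space_sample D)
  let ?E = "\<lambda>k. \<integral>D. real_risk \<phi> \<pi> (exp_aggregate \<phi> \<beta> F k D) \<partial>?P"
  have B': "\<phi> t \<in> {-B..B}" if "t \<in> {-1..1}" for t using B[OF that] by auto
  show "expected_excess_risk \<phi> X \<pi> f n
      \<le> (MIN g\<in>F. excess_risk \<phi> X \<pi> g) + ereal ((\<beta> * ln M + 2 * B) / real n)"
    unfolding f
  proof (rule expected_excess_risk_le[OF \<pi> \<phi> B K F M1 st n CAEW_bounded[OF F M1 n]])
    fix g assume g: "g \<in> F"
    have Rg: "real_risk \<phi> \<pi> g \<le> B" using real_risk_bounds[OF \<pi> \<phi> B' FD(4,5)[OF g]] by auto
    have ms: "(\<lambda>(D, x). exp_aggregate \<phi> \<beta> F 0 D x) \<in> borel_measurable (sample_space X n \<Otimes>\<^sub>M X)"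
      by (rule exp_aggregate_measurable[OF \<phi> F M1]) simp
    \<comment> \<open>CAEW averages \<open>k = 1..n\<close> instead of the \<open>k = 0..n\<close> of the telescoping bound; the difference
      costs a constant, absorbed by \<open>ln M \<ge> ln 2\<close>.\<close>
    have E0: "- B \<le> ?E 0"
    proof (rule P.integral_ge_const)
      show "integrable ?P (\<lambda>D. real_risk \<phi> \<pi> (exp_aggregate \<phi> \<beta> F 0 D))"
        by (rule integrable_real_risk[OF \<pi> \<phi> B ms exp_aggregate_bounded[OF F M1]])
      show "AE D in ?P. - B \<le> real_risk \<phi> \<pi> (exp_aggregate \<phi> \<beta> F 0 D)"
      proof (rule AE_I2)
        fix D assume "D \<in> space ?P"
        then have D: "D \<in> space (sample_space X n)" by (simp only: space_sample[OF \<pi>])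
        have "exp_aggregate \<phi> \<beta> F 0 D \<in> borel_measurable X" using measurable_Pair2[OF ms D] by simp
        from real_risk_bounds[OF \<pi> \<phi> B' this exp_aggregate_bounded[OF F M1]]
        show "- B \<le> real_risk \<phi> \<pi> (exp_aggregate \<phi> \<beta> F 0 D)" by auto
      qed
    qed
    have "(\<Sum>k<Suc n. ?E k) \<le> real (Suc n) * real_risk \<phi> \<pi> g + \<beta> * ln M"
      by (rule exp_aggregate_cumulative_risk_le[OF \<pi> \<phi> B conc \<beta> F M1 g])
    moreover have "(\<Sum>k<Suc n. ?E k) = ?E 0 + (\<Sum>k=1..n. ?E k)"
      unfolding sum.lessThan_Suc_shift using sum.shift_bounds_Suc_ivl[of ?E 0 n]
      by (simp add: lessThan_atLeast0 atLeastLessThanSuc_atLeastAtMost One_nat_def)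
    \<comment> \<open>One \<open>B\<close> pays for the surplus copy of the risk of
      \<open>g\<close>, the other for dropping \<open>?E 0\<close>.\<close>
    ultimately have "(\<Sum>k=1..n. ?E k) \<le> real n * real_risk \<phi> \<pi> g + (\<beta> * ln M + 2 * B)"
      using E0 Rg by (simp add: algebra_simps)
    then have "(1 / real n) * (\<Sum>k=1..n. ?E k)
        \<le> (1 / real n) * (real n * real_risk \<phi> \<pi> g + (\<beta> * ln M + 2 * B))"
      by (intro mult_left_mono) auto
    also have "\<dots> = real_risk \<phi> \<pi> g + (\<beta> * ln M + 2 * B) / real n"
      using n by (simp add: field_simps)
    finally show "(\<integral>D. real_risk \<phi> \<pi> (?f n D) \<partial>?P) \<le> real_risk \<phi> \<pi> g + (\<beta> * ln M + 2 * B) / real n"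
      using CAEW_risk_le[OF \<pi> \<phi> B conv F M1 n, of \<beta>] by linarith
  qed
qed

text \<open>With b = 1 / \<beta>, the second derivative of exp (-b \<phi>) is nonpositive iff
  \<open>b * (2 * a * t - 1)\<^sup>2 \<le> 2 * a\<close>. On [-1, 1] the square is largest at t =
  -1, with value \<open>(2 * a + 1)\<^sup>2\<close>, so this \<beta> is the least admissible
  temperature.\<close>

lemma quadratic_loss_exp_concave:
  assumes a: "a > 0"
  defines "\<beta> \<equiv> (2 * a + 1)\<^sup>2 / (2 * a)"
  shows "concave_on {-1..1} (\<lambda>t::real. exp (- (inverse \<beta> * (a * t\<^sup>2 - t + 1))))"
proof (rule f''_le0_imp_concave)
  have \<beta>: "\<beta> > 0" unfolding \<beta>_def using a by (intro divide_pos_pos) auto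
  define b where "b = inverse \<beta>"
  have b: "b > 0" "b * (2 * a + 1)\<^sup>2 = 2 * a" using \<beta> a by (auto simp: b_def \<beta>_def)
  let ?E = "\<lambda>t::real. exp (- (b * (a * t\<^sup>2 - t + 1)))"
  show "((\<lambda>t. exp (- (inverse \<beta> * (a * t\<^sup>2 - t + 1)))) has_real_derivative
      - (b * (2 * a * t - 1)) * ?E t) (at t)" for t
    unfolding b_def by (auto intro!: derivative_eq_intros simp: algebra_simps)
  show "((\<lambda>t. - (b * (2 * a * t - 1)) * ?E t) has_real_derivative
      b * (b * (2 * a * t - 1)\<^sup>2 - 2 * a) * ?E t) (at t)" for t
    by (auto intro!: derivative_eq_intros simp: algebra_simps power2_eq_square)
  fix t :: real assume t: "t \<in> {-1..1}"
  have "\<bar>2 * a * t - 1\<bar> \<le> \<bar>2 * a + 1\<bar>"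
  proof -
    have "a * t \<le> a" "- a \<le> a * t" using a t mult_left_mono[of t 1 a] mult_left_mono[of "-1" t a] by auto
    then show ?thesis by linarith
  qed
  then have "(2 * a * t - 1)\<^sup>2 \<le> (2 * a + 1)\<^sup>2" by (simp add: abs_le_square_iff)
  then have "b * (2 * a * t - 1)\<^sup>2 \<le> 2 * a" using b mult_left_mono[of "(2 * a * t - 1)\<^sup>2" _ b] by fastforce
  then show "b * (b * (2 * a * t - 1)\<^sup>2 - 2 * a) * ?E t \<le> 0"
    using b(1) by (simp add: mult_le_0_iff)
qed simp

section \<open>The hypercube of distributions\<close>

text \<open>The cells of a labelling have only finitely many unions, so an infinite \<sigma>-algebra
  contains a set that is not one of them. Such a set cuts a cell in two nonempty measurable pieces,
  which gives one more label.\<close>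

lemma measurable_labelling:
  assumes inf: "infinite (sets X)"
  shows "\<exists>c. c \<in> X \<rightarrow>\<^sub>M count_space (UNIV :: nat set) \<and> c ` space X = {..m}"
proof (induction m)
  case 0
  have "space X \<noteq> {}" using inf space_empty_iff[of X] by auto
  then show ?case by (intro exI[of _ "\<lambda>_. 0"]) auto
next
  case (Suc m)
  then obtain c where c[measurable]: "c \<in> X \<rightarrow>\<^sub>M count_space (UNIV :: nat set)" and im: "c ` space X = {..m}" by auto
  let ?U = "(\<lambda>J. c -` J \<inter> space X) ` Pow {..m}"
  have "\<not> sets X \<subseteq> ?U" using inf finite_subset[of "sets X" ?U] by auto
  then obtain A where A: "A \<in> sets X" "A \<notin> ?U" by auto
  have "\<exists>x\<in>space X. \<exists>y\<in>space X. c x = c y \<and> x \<in> A \<and> y \<notin> A"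
  proof (rule ccontr)
    assume no: "\<not> ?thesis"
    have sub: "A \<subseteq> space X" using sets.sets_into_space[OF A(1)] .
    have "A = c -` (c ` A) \<inter> space X"
    proof (intro equalityI subsetI)
      fix z assume z: "z \<in> c -` (c ` A) \<inter> space X"
      then obtain x where "x \<in> A" "c x = c z" by auto
      then show "z \<in> A" using no sub z by auto
    qed (use sub in auto)
    moreover have "c ` A \<in> Pow {..m}" using sub im by auto
    ultimately have "A \<in> ?U" by (rule image_eqI)
    then show False using A(2) by simp
  qed
  then obtain x y where xy: "x \<in> space X" "y \<in> space X" "c x = c y" "x \<in> A" "y \<notin> A" by auto
  define c' where "c' = (\<lambda>z. if c z = c x \<and> z \<notin> A then Suc m else c z)"
  have "c' \<in> X \<rightarrow>\<^sub>M count_space UNIV"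
    unfolding c'_def using A(1) by measurable
  moreover have "c' ` space X = {..Suc m}"
  proof
    have "c z \<le> m" if "z \<in> space X" for z using im that by (metis atMost_iff image_eqI)
    then show "c' ` space X \<subseteq> {..Suc m}" by (auto simp: c'_def le_SucI)
    show "{..Suc m} \<subseteq> c' ` space X"
    proof
      fix i assume "i \<in> {..Suc m}"
      then consider "i = Suc m" | "i = c x" | "i \<le> m" "i \<noteq> c x" by fastforce
      then show "i \<in> c' ` space X"
      proof cases
        case 1 then show ?thesis using xy by (intro image_eqI[of _ _ y]) (auto simp: c'_def)
      next
        case 2 then show ?thesis using xy by (intro image_eqI[of _ _ x]) (auto simp: c'_def)
      next
        case 3
        then obtain z where "z \<in> space X" "c z = i" using im by (metis atMost_iff imageE)
        then show ?thesis using 3 by (intro image_eqI[of _ _ z]) (auto simp: c'_def)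
      qed
    qed
  qed
  ultimately show ?case by blast
qed

text \<open>Replaces the Cauchy--Schwarz step that bounds the overlap of two densities by their Hellinger
  affinity.\<close>

lemma half_sqrt_le_min:
  assumes "(a::real) \<ge> 0" "b \<ge> 0"
  shows "sqrt (a * b) / 2 - (a + b) / 16 \<le> min a b"
proof -
  \<comment> \<open>The weights 4 and 1/4 make the coefficient of the maximum small: for two
    densities of mass 1 with affinity at least 1/2, the bound leaves 1/4 - 2/16 = 1/8.\<close>
  have "sqrt (a * b) = sqrt ((4 * min a b) * (max a b / 4))" by (simp add: min_def max_def mult.commute)
  also have "\<dots> \<le> (4 * min a b + max a b / 4) / 2"
    using assms by (intro arith_geo_mean_sqrt) auto
  finally have "sqrt (a * b) / 2 \<le> min a b + max a b / 16" by simp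
  moreover have "max a b \<le> a + b" using assms by simp
  ultimately show ?thesis by argo
qed

lemma sqrt_prod: "sqrt (\<Prod>i\<in>A. f i) = (\<Prod>i\<in>A. sqrt (f i))"
  by (induction A rule: infinite_finite_induct) (simp_all add: real_sqrt_mult)

text \<open>The value 0 off {1..N} makes the label a fair coin on cell 0.\<close>

definition cube_sign :: "nat \<Rightarrow> nat set \<Rightarrow> nat \<Rightarrow> real" where
  "cube_sign N \<sigma> j = (if j \<in> {1..N} then if j \<in> \<sigma> then 1 else -1 else 0)"

text \<open>The amplitude \<open>b\<close> is meant to be that of the minimizer of the risk on a
  cell. The restriction makes the function extensional, as dictionaries demand.\<close>

definition cube_function :: "'a measure \<Rightarrow> ('a \<Rightarrow> nat) \<Rightarrow> nat \<Rightarrow> real \<Rightarrow> nat set \<Rightarrow> 'a \<Rightarrow> real" where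
  "cube_function X c N b \<sigma> = restrict (\<lambda>x. b * cube_sign N \<sigma> (c x)) (space X)"

section \<open>The laws at the vertices of the hypercube\<close>

locale hypercube =
  fixes X :: "'a measure" and c :: "'a \<Rightarrow> nat" and p :: "nat \<Rightarrow> 'a" and N :: nat and q \<epsilon> :: real
  assumes c[measurable]: "c \<in> X \<rightarrow>\<^sub>M count_space UNIV"
    and p: "\<And>j. j \<le> N \<Longrightarrow> p j \<in> space X" "\<And>j. j \<le> N \<Longrightarrow> c (p j) = j"
    and q: "0 \<le> q" "real N * q \<le> 1"
    and \<epsilon>: "0 \<le> \<epsilon>" "\<epsilon> \<le> 1"
begin

definition wt :: "nat \<Rightarrow> real" where "wt j = (if j = 0 then 1 - real N * q else q)"

abbreviation "atoms \<equiv> {..N} \<times> {-1, 1 :: real}"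

text \<open>Cell \<open>j\<close> is charged only at its representative \<open>p j\<close>, with a
  symmetric label. Singletons may fail to be measurable in \<open>X\<close>, so the law is built as
  the image of a finite point measure.\<close>

definition base :: "('a \<times> real) measure" where
  "base = distr (point_measure atoms (\<lambda>(j, y). ennreal (wt j / 2))) (obs_space X) (\<lambda>(j, y). (p j, y))"

text \<open>All distributions of the hypercube have a density with respect to \<open>base\<close>, which reduces
  comparisons between them to integrals of densities.\<close>

definition dens :: "nat set \<Rightarrow> 'a \<times> real \<Rightarrow> real" where
  "dens \<sigma> z = 1 + \<epsilon> * snd z * cube_sign N \<sigma> (c (fst z))"

definition cube :: "nat set \<Rightarrow> ('a \<times> real) measure" where
  "cube \<sigma> = density base (\<lambda>z. ennreal (dens \<sigma> z))"

lemma wt_nonneg: "wt j \<ge> 0" using q by (simp add: wt_def)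

lemma sum_wt: "(\<Sum>j\<le>N. wt j) = 1"
proof -
  have "(\<Sum>j\<le>N. wt j) = wt 0 + (\<Sum>j=1..N. wt j)"
    by (simp add: atMost_atLeast0 sum.atLeast_Suc_atMost One_nat_def)
  also have "(\<Sum>j=1..N. wt j) = real N * q" by (simp add: wt_def)
  finally show ?thesis by (simp add: wt_def)
qed

lemma atoms_measurable: "(\<lambda>(j, y). (p j, y)) \<in> point_measure atoms w \<rightarrow>\<^sub>M obs_space X"
  using p(1) by (auto simp: measurable_point_measure_eq1 obs_space_def space_pair_measure)

lemma sets_base [measurable_cong]: "sets base = sets (obs_space X)" by (simp add: base_def)

text \<open>Only finitely many points are charged, so unbounded functions are integrable as well.
  This is what makes the risk of an arbitrary statistic a real number under the hypercube
  laws.\<close>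

lemma base_integral:
  assumes H: "H \<in> borel_measurable (obs_space X)"
  shows "integrable base (H :: _ \<Rightarrow> real)"
    and "(\<integral>z. H z \<partial>base) = (\<Sum>j\<le>N. wt j * ((H (p j, 1) + H (p j, -1)) / 2))"
proof -
  let ?P = "point_measure atoms (\<lambda>(j, y). ennreal (wt j / 2))"
  show "integrable base H"
    unfolding base_def using H atoms_measurable
    using integrable_point_measure_finite[of atoms "\<lambda>a. wt (fst a) / 2" "\<lambda>a. H (p (fst a), snd a)"]
    by (subst integrable_distr_eq) (auto simp: case_prod_unfold)
  have "(\<integral>z. H z \<partial>base) = (\<integral>a. H (p (fst a), snd a) \<partial>?P)"
    unfolding base_def using H atoms_measurable by (subst integral_distr) (auto simp: case_prod_unfold)
  also have "\<dots> = (\<Sum>a\<in>atoms. wt (fst a) / 2 * H (p (fst a), snd a))"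
    using lebesgue_integral_point_measure_finite[of atoms "\<lambda>a. wt (fst a) / 2" "\<lambda>a. H (p (fst a), snd a)"]
    by (simp add: case_prod_unfold wt_nonneg)
  also have "\<dots> = (\<Sum>j\<le>N. \<Sum>y\<in>{-1, 1}. wt j / 2 * H (p j, y))"
    by (simp only: sum.cartesian_product case_prod_unfold)
  also have "\<dots> = (\<Sum>j\<le>N. wt j * ((H (p j, 1) + H (p j, -1)) / 2))"
    by (intro sum.cong) (auto simp: field_simps)
  finally show "(\<integral>z. H z \<partial>base) = (\<Sum>j\<le>N. wt j * ((H (p j, 1) + H (p j, -1)) / 2))" .
qed

lemma prob_space_base: "prob_space base"
proof -
  have "emeasure (point_measure atoms (\<lambda>(j, y). ennreal (wt j / 2))) atoms
      = (\<Sum>a\<in>atoms. ennreal (wt (fst a) / 2))"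
    by (subst emeasure_point_measure_finite) (auto simp: case_prod_unfold)
  also have "\<dots> = ennreal (\<Sum>a\<in>atoms. wt (fst a) / 2)" using wt_nonneg by (simp add: sum_ennreal)
  also have "(\<Sum>a\<in>atoms. wt (fst a) / 2) = (\<Sum>j\<le>N. \<Sum>y\<in>{-1, 1::real}. wt j / 2)"
    by (simp only: sum.cartesian_product case_prod_unfold)
  also have "\<dots> = 1" using sum_wt by simp
  finally have "prob_space (point_measure atoms (\<lambda>(j, y). ennreal (wt j / 2)))"
    by (intro prob_spaceI) (simp add: space_point_measure)
  then show ?thesis unfolding base_def by (rule prob_space.prob_space_distr) (rule atoms_measurable)
qed

lemma cube_sign_bounded: "\<bar>cube_sign N \<sigma> j\<bar> \<le> 1" by (simp add: cube_sign_def)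

lemma dens_bounds:
  assumes "z \<in> space (obs_space X)"
  shows "dens \<sigma> z \<in> {0..2}"
proof -
  have "snd z \<in> {-1, 1}" using assms by (auto simp: obs_space_def space_pair_measure)
  then have "\<bar>\<epsilon> * snd z * cube_sign N \<sigma> (c (fst z))\<bar> \<le> 1 * 1 * 1"
    unfolding abs_mult using \<epsilon> by (intro mult_mono cube_sign_bounded) auto
  then show ?thesis unfolding dens_def by auto
qed

lemma dens_measurable [measurable]: "dens \<sigma> \<in> borel_measurable (obs_space X)"
  unfolding dens_def by measurable

lemma AE_dens: "AE z in base. 0 \<le> dens \<sigma> z"
proof (rule AE_I2)
  fix z assume "z \<in> space base"
  then show "0 \<le> dens \<sigma> z" using dens_bounds[of z \<sigma>] sets_eq_imp_space_eq[OF sets_base] by simp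
qed

lemma cube_integral:
  assumes H[measurable]: "H \<in> borel_measurable (obs_space X)"
  shows "integrable (cube \<sigma>) (H :: _ \<Rightarrow> real)"
    and "(\<integral>z. H z \<partial>cube \<sigma>) = (\<Sum>j\<le>N. wt j * ((1 + \<epsilon> * cube_sign N \<sigma> j) / 2 * H (p j, 1)
       + (1 - \<epsilon> * cube_sign N \<sigma> j) / 2 * H (p j, -1)))"
proof -
  have m: "(\<lambda>z. dens \<sigma> z * H z) \<in> borel_measurable (obs_space X)" by measurable
  have "integrable base (\<lambda>z. dens \<sigma> z *\<^sub>R H z)" using base_integral(1)[OF m] by simp
  then show "integrable (cube \<sigma>) H" unfolding cube_def
    by (subst integrable_density) (auto simp: AE_dens)
  have "(\<integral>z. H z \<partial>cube \<sigma>) = (\<integral>z. dens \<sigma> z *\<^sub>R H z \<partial>base)"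
    unfolding cube_def by (subst integral_density) (auto simp: AE_dens)
  also have "\<dots> = (\<Sum>j\<le>N. wt j * ((dens \<sigma> (p j, 1) * H (p j, 1) + dens \<sigma> (p j, -1) * H (p j, -1)) / 2))"
    using base_integral(2)[OF m] by simp
  also have "\<dots> = (\<Sum>j\<le>N. wt j * ((1 + \<epsilon> * cube_sign N \<sigma> j) / 2 * H (p j, 1)
       + (1 - \<epsilon> * cube_sign N \<sigma> j) / 2 * H (p j, -1)))"
    by (intro sum.cong refl) (simp add: dens_def p field_simps)
  finally show "(\<integral>z. H z \<partial>cube \<sigma>) = (\<Sum>j\<le>N. wt j * ((1 + \<epsilon> * cube_sign N \<sigma> j) / 2 * H (p j, 1)
       + (1 - \<epsilon> * cube_sign N \<sigma> j) / 2 * H (p j, -1)))" .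
qed

lemma sets_cube [measurable_cong]: "sets (cube \<sigma>) = sets (obs_space X)" by (simp add: cube_def sets_base)

lemma dens_integral: "(\<integral>z. dens \<sigma> z \<partial>base) = 1"
proof -
  have "(\<integral>z. dens \<sigma> z \<partial>base) = (\<Sum>j\<le>N. wt j)"
    unfolding base_integral(2)[OF dens_measurable] by (intro sum.cong refl) (simp add: dens_def)
  then show ?thesis using sum_wt by simp
qed

lemma cube_pair_distributions: "cube \<sigma> \<in> pair_distributions X"
proof -
  have "emeasure (cube \<sigma>) (space (cube \<sigma>)) = (\<integral>\<^sup>+ z. ennreal (dens \<sigma> z) \<partial>base)"
    unfolding cube_def by (simp add: emeasure_density cong: nn_integral_cong)
  also have "\<dots> = ennreal (\<integral>z. dens \<sigma> z \<partial>base)"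
    by (rule nn_integral_eq_integral[OF base_integral(1)[OF dens_measurable] AE_dens])
  finally have "prob_space (cube \<sigma>)" by (intro prob_spaceI) (simp add: dens_integral)
  then show ?thesis by (simp add: pair_distributions_def sets_cube)
qed

lemma space_base_sample: "space (PiM {1..n} (\<lambda>_. base)) = space (sample_space X n)"
  unfolding sample_space_def by (intro sets_eq_imp_space_eq sets_PiM_cong) (simp_all add: sets_base)

lemma sets_base_sample: "sets (PiM {1..n} (\<lambda>_. base)) = sets (sample_space X n)"
  unfolding sample_space_def by (intro sets_PiM_cong) (simp_all add: sets_base)

lemma sample_component_space:
  fixes n :: nat
  assumes "D \<in> space (PiM {1..n} (\<lambda>_. base))" "i \<in> {1..n}"
  shows "D i \<in> space (obs_space X)"
  using assms PiE_mem[of D "{1..n}" "\<lambda>_. space (obs_space X)" i]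
  unfolding space_base_sample by (simp add: sample_space_def space_PiM)

text \<open>Checked on rectangles, which determine the product measure. All sample laws of the
  hypercube can then be compared as densities under one measure.\<close>

lemma PiM_cube:
  fixes n :: nat
  shows "PiM {1..n} (\<lambda>_. cube \<sigma>) = density (PiM {1..n} (\<lambda>_. base)) (\<lambda>D. ennreal (\<Prod>i\<in>{1..n}. dens \<sigma> (D i)))"
proof -
  interpret b: prob_space base by (rule prob_space_base)
  interpret c: prob_space "cube \<sigma>" using cube_pair_distributions by (simp add: pair_distributions_def)
  interpret B: product_sigma_finite "\<lambda>_::nat. base" ..
  interpret C: product_sigma_finite "\<lambda>_::nat. cube \<sigma>" ..
  let ?B = "PiM {1..n} (\<lambda>_. base)" and ?G = "\<lambda>D. \<Prod>i\<in>{1..n}. dens \<sigma> (D i)"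
  have gm: "?G \<in> borel_measurable ?B" by measurable
  have "density ?B (\<lambda>D. ennreal (?G D)) = PiM {1..n} (\<lambda>_. cube \<sigma>)"
  proof (rule C.PiM_eqI)
    show "sets (density ?B (\<lambda>D. ennreal (?G D))) = sets (PiM {1..n} (\<lambda>_. cube \<sigma>))"
      unfolding sets_density by (intro sets_PiM_cong) (simp_all add: sets_base sets_cube)
    fix A assume A: "\<And>i. i \<in> {1..n} \<Longrightarrow> A i \<in> sets (cube \<sigma>)"
    then have A': "A i \<in> sets base" if "i \<in> {1..n}" for i using that by (simp add: sets_base sets_cube)
    have "emeasure (density ?B (\<lambda>D. ennreal (?G D))) (PiE {1..n} A)
      = (\<integral>\<^sup>+ D. ennreal (?G D) * indicator (PiE {1..n} A) D \<partial>?B)"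
      using gm A' by (intro emeasure_density sets_PiM_I_finite) auto
    also have "\<dots> = (\<integral>\<^sup>+ D. (\<Prod>i\<in>{1..n}. ennreal (dens \<sigma> (D i)) * indicator (A i) (D i)) \<partial>?B)"
    proof (rule nn_integral_cong)
      fix D assume D: "D \<in> space ?B"
      have "ennreal (?G D) = (\<Prod>i\<in>{1..n}. ennreal (dens \<sigma> (D i)))"
        using dens_bounds[OF sample_component_space[OF D]] by (subst prod_ennreal) auto
      moreover have "indicator (PiE {1..n} A) D = (\<Prod>i\<in>{1..n}. indicator (A i) (D i) :: ennreal)"
        using D by (auto simp: indicator_def PiE_iff space_PiM)
      ultimately show "ennreal (?G D) * indicator (PiE {1..n} A) D
          = (\<Prod>i\<in>{1..n}. ennreal (dens \<sigma> (D i)) * indicator (A i) (D i))"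
        by (simp add: prod.distrib)
    qed
    also have "\<dots> = (\<Prod>i\<in>{1..n}. \<integral>\<^sup>+ z. ennreal (dens \<sigma> z) * indicator (A i) z \<partial>base)"
      using A' by (intro B.product_nn_integral_prod) auto
    also have "\<dots> = (\<Prod>i\<in>{1..n}. emeasure (cube \<sigma>) (A i))"
      using A' unfolding cube_def by (intro prod.cong refl) (simp add: emeasure_density)
    finally show "emeasure (density ?B (\<lambda>D. ennreal (?G D))) (PiE {1..n} A)
        = (\<Prod>i\<in>{1..n}. emeasure (cube \<sigma>) (A i))" .
  qed simp
  then show ?thesis by simp
qed

section \<open>Neighbouring vertices and the overlap of their sample laws\<close>

definition flip :: "nat \<Rightarrow> nat set \<Rightarrow> nat set" where
  "flip j \<sigma> = (if j \<in> \<sigma> then \<sigma> - {j} else insert j \<sigma>)"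

lemma cube_sign_flip: "j \<in> {1..N} \<Longrightarrow> cube_sign N (flip j \<sigma>) i = (if i = j then - cube_sign N \<sigma> i else cube_sign N \<sigma> i)"
  by (auto simp: cube_sign_def flip_def)

lemma bij_betw_flip: "j \<in> {1..N} \<Longrightarrow> bij_betw (flip j) (Pow {1..N}) (Pow {1..N})"
  by (rule bij_betwI[where g = "flip j"]) (auto simp: flip_def split: if_splits)

text \<open>Off cell \<open>j\<close> the two densities coincide and the square root is the density
  itself. On cell \<open>j\<close>, of mass \<open>q\<close>, both labels give
  \<open>sqrt (1 - \<epsilon>\<^sup>2)\<close>, which is at least
  \<open>1 - \<epsilon>\<^sup>2\<close>.\<close>

lemma affinity_ge:
  assumes j: "j \<in> {1..N}"
  shows "(\<integral>z. sqrt (dens \<sigma> z * dens (flip j \<sigma>) z) \<partial>base) \<ge> 1 - q * \<epsilon>\<^sup>2"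
proof -
  let ?h = "\<lambda>z. sqrt (dens \<sigma> z * dens (flip j \<sigma>) z)"
  have m: "?h \<in> borel_measurable (obs_space X)" by measurable
  have e2: "\<epsilon>\<^sup>2 \<le> 1" using \<epsilon> by (simp add: power_le_one)
  have sq: "1 - \<epsilon>\<^sup>2 \<le> sqrt (1 - \<epsilon>\<^sup>2)"
  proof (rule real_le_rsqrt)
    show "(1 - \<epsilon>\<^sup>2)\<^sup>2 \<le> 1 - \<epsilon>\<^sup>2" unfolding power2_eq_square[of "1 - \<epsilon>\<^sup>2"]
      using e2 by (intro mult_left_le) auto
  qed
  have "1 - q * \<epsilon>\<^sup>2 = (\<Sum>i\<le>N. wt i * (1 - (if i = j then \<epsilon>\<^sup>2 else 0)))"
  proof -
    have "(\<Sum>i\<le>N. wt i * (1 - (if i = j then \<epsilon>\<^sup>2 else 0))) = (\<Sum>i\<le>N. wt i) - (\<Sum>i\<le>N. if i = j then wt i * \<epsilon>\<^sup>2 else 0)"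
      unfolding sum_subtractf[symmetric] by (intro sum.cong) (auto simp: right_diff_distrib)
    also have "(\<Sum>i\<le>N. if i = j then wt i * \<epsilon>\<^sup>2 else 0) = q * \<epsilon>\<^sup>2"
      using j by (simp add: wt_def)
    finally show ?thesis by (simp add: sum_wt)
  qed
  also have "\<dots> \<le> (\<Sum>i\<le>N. wt i * ((?h (p i, 1) + ?h (p i, -1)) / 2))"
  proof (intro sum_mono mult_left_mono wt_nonneg)
    fix i assume "i \<in> {..N}"
    then have i: "i \<le> N" by simp
    show "1 - (if i = j then \<epsilon>\<^sup>2 else 0) \<le> (?h (p i, 1) + ?h (p i, -1)) / 2"
    proof (cases "i = j")
      case True
      have "cube_sign N \<sigma> j = 1 \<or> cube_sign N \<sigma> j = -1" using j by (simp add: cube_sign_def)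
      then have "?h (p i, y) = sqrt (1 - \<epsilon>\<^sup>2)" if "y \<in> {-1, 1}" for y
        using that True cube_sign_flip[OF j, of \<sigma> j] i
        by (auto simp: dens_def p power2_eq_square algebra_simps)
      then show ?thesis using sq True by simp
    next
      case False
      have "dens \<sigma> (p i, y) \<ge> 0" if "y \<in> {-1, 1}" for y
        using dens_bounds[of "(p i, y)" \<sigma>] p(1)[OF i] that by (auto simp: obs_space_def space_pair_measure)
      then have h: "?h (p i, y) = dens \<sigma> (p i, y)" if "y \<in> {-1, 1}" for y
        using that False cube_sign_flip[OF j, of \<sigma> i] i by (simp add: dens_def p)
      have "?h (p i, 1) + ?h (p i, -1) = dens \<sigma> (p i, 1) + dens \<sigma> (p i, -1)"
        using h[of 1] h[of "-1"] by simp
      also have "\<dots> = 2" by (simp add: dens_def)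
      finally show ?thesis using False by simp
    qed
  qed
  also have "\<dots> = (\<integral>z. ?h z \<partial>base)" using base_integral(2)[OF m] by simp
  finally show ?thesis .
qed

text \<open>The Hellinger affinity is multiplicative over the sample, and Bernoulli's inequality
  with \<open>small\<close> keeps it at least 1/2. By \<open>half_sqrt_le_min\<close> the overlap is
  then at least 1/4 - 2/16.\<close>

lemma integral_min_density_ge:
  assumes j: "j \<in> {1..N}" and small: "real n * (q * \<epsilon>\<^sup>2) \<le> 1 / 2"
  defines "G \<equiv> \<lambda>\<sigma> D. \<Prod>i\<in>{1..n}. dens \<sigma> (D i)"
  shows "integrable (PiM {1..n} (\<lambda>_. base)) (\<lambda>D. min (G \<sigma> D) (G (flip j \<sigma>) D))"
    and "1 / 8 \<le> (\<integral>D. min (G \<sigma> D) (G (flip j \<sigma>) D) \<partial>PiM {1..n} (\<lambda>_. base))"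
proof -
  interpret b: prob_space base by (rule prob_space_base)
  interpret B: product_sigma_finite "\<lambda>_::nat. base" ..
  let ?B = "PiM {1..n} (\<lambda>_. base)" and ?\<tau> = "flip j \<sigma>"
  let ?h = "\<lambda>z. sqrt (dens \<sigma> z * dens ?\<tau> z)"
  note idens = base_integral(1)[OF dens_measurable]
  have iG: "integrable ?B (G \<upsilon>)" for \<upsilon>
    unfolding G_def using idens by (intro B.product_integrable_prod) auto
  have eG: "(\<integral>D. G \<upsilon> D \<partial>?B) = 1" for \<upsilon>
    unfolding G_def using idens by (subst B.product_integral_prod) (auto simp: dens_integral)
  have G0: "G \<upsilon> D \<ge> 0" if "D \<in> space ?B" for \<upsilon> D
    unfolding G_def using dens_bounds[OF sample_component_space[OF that]] by (intro prod_nonneg) auto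
  have m: "?h \<in> borel_measurable (obs_space X)" by measurable
  note ih = base_integral(1)[OF m]
  have sG: "sqrt (G \<sigma> D * G ?\<tau> D) = (\<Prod>i\<in>{1..n}. ?h (D i))" for D
    unfolding G_def prod.distrib[symmetric] by (rule sqrt_prod)
  have isq: "integrable ?B (\<lambda>D. sqrt (G \<sigma> D * G ?\<tau> D))"
    unfolding sG using ih by (intro B.product_integrable_prod) auto
  have qe: "q * \<epsilon>\<^sup>2 \<le> 1"
  proof -
    have "1 * q \<le> real N * q" using j q by (intro mult_right_mono) auto
    then have "q \<le> 1" using q by simp
    moreover have "\<epsilon>\<^sup>2 \<le> 1" using \<epsilon> by (simp add: power_le_one)
    ultimately show ?thesis using q by (intro mult_le_one) auto
  qed
  have "1 / 2 \<le> 1 + real n * (- (q * \<epsilon>\<^sup>2))" using small by simp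
  also have "\<dots> \<le> (1 + - (q * \<epsilon>\<^sup>2)) ^ n" using qe by (intro Bernoulli_inequality) simp
  also have "\<dots> \<le> (\<integral>z. ?h z \<partial>base) ^ n" using affinity_ge[OF j, of \<sigma>] qe by (intro power_mono) auto
  also have "\<dots> = (\<integral>D. sqrt (G \<sigma> D * G ?\<tau> D) \<partial>?B)"
    unfolding sG using ih by (subst B.product_integral_prod) auto
  finally have half: "1 / 2 \<le> (\<integral>D. sqrt (G \<sigma> D * G ?\<tau> D) \<partial>?B)" .
  show im: "integrable ?B (\<lambda>D. min (G \<sigma> D) (G ?\<tau> D))" using iG by simp
  have "1 / 8 \<le> (\<integral>D. sqrt (G \<sigma> D * G ?\<tau> D) \<partial>?B) / 2 - (1 + 1) / 16" using half by simp
  also have "\<dots> = (\<integral>D. sqrt (G \<sigma> D * G ?\<tau> D) / 2 - (G \<sigma> D + G ?\<tau> D) / 16 \<partial>?B)"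
    using iG eG isq by simp
  also have "\<dots> \<le> (\<integral>D. min (G \<sigma> D) (G ?\<tau> D) \<partial>?B)"
    using iG isq im G0 by (intro integral_mono half_sqrt_le_min) auto
  finally show "1 / 8 \<le> (\<integral>D. min (G \<sigma> D) (G ?\<tau> D) \<partial>?B)" .
qed

end

text \<open>The conditional risk of predicting \<open>t\<close> at a point where the label has mean
  \<epsilon> s.\<close>

definition cell_risk :: "(real \<Rightarrow> real) \<Rightarrow> real \<Rightarrow> real \<Rightarrow> real \<Rightarrow> real" where
  "cell_risk \<phi> \<epsilon> s t = (1 + \<epsilon> * s) / 2 * \<phi> t + (1 - \<epsilon> * s) / 2 * \<phi> (- t)"

lemma ex_ge_average_ennreal:
  fixes I :: "'b \<Rightarrow> ennreal"
  assumes "finite S" "S \<noteq> {}" and "of_nat (card S) * r \<le> (\<Sum>s\<in>S. I s)"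
  shows "\<exists>s\<in>S. r \<le> I s"
proof -
  have "Max (I ` S) \<in> I ` S" using assms by (intro Max_in) auto
  then obtain s where s: "s \<in> S" "Max (I ` S) = I s" by auto
  have "(\<Sum>s\<in>S. I s) \<le> of_nat (card S) * I s"
    using assms(1) by (intro sum_bounded_above) (auto simp flip: s(2))
  with assms(3) have "of_nat (card S) * r \<le> of_nat (card S) * I s" by (rule order_trans)
  then have "r \<le> I s"
    using assms(1,2) by (subst (asm) ennreal_mult_le_mult_iff) (auto simp: of_nat_less_top)
  then show ?thesis using s(1) by blast
qed

section \<open>Assouad's argument\<close>

context hypercube
begin

lemma cube_risk:
  fixes \<phi> :: "real \<Rightarrow> real"
  assumes "\<phi> \<in> borel_measurable borel" "g \<in> borel_measurable X"
  shows "risk \<phi> (cube \<sigma>) g = ereal (\<Sum>j\<le>N. wt j * cell_risk \<phi> \<epsilon> (cube_sign N \<sigma> j) (g (p j)))"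
proof -
  note m = loss_measurable_obs[OF assms]
  show ?thesis
    by (subst risk_eq_real_risk[OF cube_integral(1)[OF m]])
       (simp add: real_risk_def cube_integral(2)[OF m] cell_risk_def)
qed

lemma sum_wt_split: "(\<Sum>j\<le>N. wt j * a j) = (1 - real N * q) * a 0 + q * (\<Sum>j=1..N. a j)"
proof -
  have "(\<Sum>j\<le>N. wt j * a j) = wt 0 * a 0 + (\<Sum>j=1..N. wt j * a j)"
    by (simp add: atMost_atLeast0 sum.atLeast_Suc_atMost One_nat_def)
  also have "(\<Sum>j=1..N. wt j * a j) = (\<Sum>j=1..N. q * a j)" by (intro sum.cong) (auto simp: wt_def)
  finally show ?thesis by (simp add: wt_def sum_distrib_left)
qed

lemma cube_function_measurable: "cube_function X c N b \<sigma> \<in> borel_measurable X"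
proof -
  have "(\<lambda>x. b * cube_sign N \<sigma> (c x)) \<in> borel_measurable X" by measurable
  then show ?thesis unfolding cube_function_def by (simp cong: measurable_cong)
qed

text \<open>\<rho> is the least cell risk, attained at \<open>b * s\<close>; \<open>gap\<close> says
  that no prediction suits both signs, the two excesses adding up to at least \<delta>;
  \<open>null\<close> makes 0 optimal on cell 0 unless that cell has no mass. Two neighbouring
  vertices share a cost of q \<delta> / 8, the overlap times q \<delta>, so a cell costs q \<delta>
  / 16 on average over the vertices, and some vertex is at least as bad as the average.\<close>

lemma minimax_lower_bound:
  fixes \<phi> :: "real \<Rightarrow> real"
  assumes \<phi>: "\<phi> \<in> borel_measurable borel"
    and pos: "\<And>s t. s \<in> {-1, 1} \<Longrightarrow> \<rho> \<le> cell_risk \<phi> \<epsilon> s t"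
    and opt: "\<And>s. s \<in> {-1, 1} \<Longrightarrow> cell_risk \<phi> \<epsilon> s (b * s) = \<rho>"
    and gap: "\<And>t. 2 * \<rho> + \<delta> \<le> cell_risk \<phi> \<epsilon> 1 t + cell_risk \<phi> \<epsilon> (-1) t"
    and null: "real N * q = 1 \<or> (\<forall>t. \<phi> 0 \<le> cell_risk \<phi> \<epsilon> 0 t)"
    and \<delta>: "0 \<le> \<delta>" and small: "real n * (q * \<epsilon>\<^sup>2) \<le> 1 / 2"
    and f: "statistic X f" and n: "n \<ge> 1"
    and F: "finite F" "\<And>\<sigma>. \<sigma> \<subseteq> {1..N} \<Longrightarrow> cube_function X c N b \<sigma> \<in> F"
  shows "\<exists>\<pi>\<in>pair_distributions X.
    (MIN g\<in>F. excess_risk \<phi> X \<pi> g) + ereal (q * real N * \<delta> / 16) \<le> expected_excess_risk \<phi> X \<pi> f n"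
proof -
  let ?B = "PiM {1..n} (\<lambda>_. base)"
  let ?R = "\<lambda>\<sigma> g. \<Sum>j\<le>N. wt j * cell_risk \<phi> \<epsilon> (cube_sign N \<sigma> j) (g (p j))"
  let ?o = "cube_function X c N b"
  define e where "e = (\<lambda>s t. cell_risk \<phi> \<epsilon> s t - \<rho>)"
  define G where "G = (\<lambda>\<sigma> D. \<Prod>i\<in>{1..n}. dens \<sigma> (D i))"
  define T where "T = (\<lambda>j D. f n D (p j))"
  have sgn: "cube_sign N \<sigma> j \<in> {-1, 1}" if "j \<in> {1..N}" for \<sigma> j using that by (simp add: cube_sign_def)
  have e0: "e (cube_sign N \<sigma> j) t \<ge> 0" if "j \<in> {1..N}" for \<sigma> j t using pos[OF sgn[OF that]] by (simp add: e_def)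
  have Ro: "?R \<sigma> (?o \<sigma>) = (1 - real N * q) * \<phi> 0 + q * (\<Sum>j=1..N. \<rho>)" for \<sigma>
  proof -
    have "?o \<sigma> (p j) = b * cube_sign N \<sigma> j" if "j \<le> N" for j
      using that p by (simp add: cube_function_def)
    moreover have "cube_sign N \<sigma> 0 = 0" by (simp add: cube_sign_def)
    moreover have "cell_risk \<phi> \<epsilon> 0 0 = \<phi> 0" by (simp add: cell_risk_def)
    ultimately show ?thesis unfolding sum_wt_split
      using opt[OF sgn] by (intro arg_cong2[where f = "(+)"] arg_cong2[where f = "(*)"] refl sum.cong) auto
  qed
  \<comment> \<open>Cell 0 contributes nothing negative to the excess, so only the informative cells
    are kept.\<close>
  have gapR: "q * (\<Sum>j=1..N. e (cube_sign N \<sigma> j) (g (p j))) \<le> ?R \<sigma> g - ?R \<sigma> (?o \<sigma>)" for \<sigma> g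
  proof -
    have "(1 - real N * q) * \<phi> 0 \<le> (1 - real N * q) * cell_risk \<phi> \<epsilon> (cube_sign N \<sigma> 0) (g (p 0))"
    proof (cases "real N * q = 1")
      case False
      then show ?thesis using null q by (intro mult_left_mono) (auto simp: cube_sign_def)
    qed simp
    then show ?thesis unfolding Ro unfolding sum_wt_split
      by (simp add: e_def sum_subtractf right_diff_distrib)
  qed
  have nonneg: "0 \<le> q * (\<Sum>j=1..N. e (cube_sign N \<sigma> j) (t j))" for \<sigma> t
    using q e0 by (intro mult_nonneg_nonneg sum_nonneg) auto
  have risk: "risk \<phi> (cube \<sigma>) g = ereal (?R \<sigma> g)" if "g \<in> borel_measurable X" for \<sigma> g
    using cube_risk[OF \<phi> that] .
  have minr: "min_risk \<phi> X (cube \<sigma>) = ereal (?R \<sigma> (?o \<sigma>))" for \<sigma>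
  proof (rule antisym)
    show "min_risk \<phi> X (cube \<sigma>) \<le> ereal (?R \<sigma> (?o \<sigma>))" unfolding min_risk_def
      using risk[OF cube_function_measurable] cube_function_measurable by (metis INF_lower)
    show "ereal (?R \<sigma> (?o \<sigma>)) \<le> min_risk \<phi> X (cube \<sigma>)" unfolding min_risk_def
    proof (rule INF_greatest)
      fix g :: "'a \<Rightarrow> real" assume "g \<in> borel_measurable X"
      from risk[OF this, of \<sigma>] show "ereal (?R \<sigma> (?o \<sigma>)) \<le> risk \<phi> (cube \<sigma>) g"
        using gapR[of \<sigma> g] nonneg[of \<sigma> "\<lambda>j. g (p j)"] by simp
    qed
  qed
  have excess: "excess_risk \<phi> X (cube \<sigma>) g = ereal (?R \<sigma> g - ?R \<sigma> (?o \<sigma>))" if "g \<in> borel_measurable X" for \<sigma> g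
    unfolding excess_risk_def minr risk[OF that] by simp
  \<comment> \<open>An upper bound on the minimum suffices, so further functions in \<open>F\<close>
    can do no harm.\<close>
  have MIN: "(MIN g\<in>F. excess_risk \<phi> X (cube \<sigma>) g) \<le> 0" if "\<sigma> \<subseteq> {1..N}" for \<sigma>
  proof -
    have "(MIN g\<in>F. excess_risk \<phi> X (cube \<sigma>) g) \<le> excess_risk \<phi> X (cube \<sigma>) (?o \<sigma>)"
      using F(1) F(2)[OF that] by (intro Min_le) auto
    then show ?thesis by (simp add: excess[OF cube_function_measurable] zero_ereal_def)
  qed
  define I where "I = (\<lambda>\<sigma>. \<integral>\<^sup>+ D. ennreal (q * (\<Sum>j=1..N. e (cube_sign N \<sigma> j) (T j D))) \<partial>PiM {1..n} (\<lambda>_. cube \<sigma>))"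
  have eer: "enn2ereal (I \<sigma>) \<le> expected_excess_risk \<phi> X (cube \<sigma>) f n" for \<sigma>
  proof -
    let ?P = "PiM {1..n} (\<lambda>_. cube \<sigma>)"
    have ex: "ereal (q * (\<Sum>j=1..N. e (cube_sign N \<sigma> j) (T j D))) \<le> excess_risk \<phi> X (cube \<sigma>) (f n D)"
      if "D \<in> space ?P" for D
    proof -
      have "D \<in> space (sample_space X n)" using that by (simp only: space_sample[OF cube_pair_distributions])
      from excess[OF statistic_section[OF f n this], of \<sigma>] show ?thesis
        using gapR[of \<sigma> "f n D"] by (simp add: T_def)
    qed
    have "expected_excess_risk \<phi> X (cube \<sigma>) f n
        = enn2ereal (\<integral>\<^sup>+ D. e2ennreal (excess_risk \<phi> X (cube \<sigma>) (f n D)) \<partial>?P)"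
      unfolding expected_excess_risk_def
    proof (rule ext_expectation_nonneg)
      fix D assume "D \<in> space ?P"
      from order_trans[OF _ ex[OF this]] show "0 \<le> excess_risk \<phi> X (cube \<sigma>) (f n D)"
        using nonneg[of \<sigma> "\<lambda>j. T j D"] by simp
    qed
    moreover have "I \<sigma> \<le> (\<integral>\<^sup>+ D. e2ennreal (excess_risk \<phi> X (cube \<sigma>) (f n D)) \<partial>?P)"
      unfolding I_def using ex by (intro nn_integral_mono) (metis e2ennreal_ereal e2ennreal_mono)
    ultimately show ?thesis by (simp add: less_eq_ennreal.rep_eq)
  qed
  define A where "A = (\<lambda>j \<sigma>. \<integral>\<^sup>+ D. ennreal (q * e (cube_sign N \<sigma> j) (T j D)) * ennreal (G \<sigma> D) \<partial>?B)"
  have Tm: "T j \<in> borel_measurable ?B" if "j \<in> {1..N}" for j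
  proof -
    have "(\<lambda>(D, x). f n D x) \<in> borel_measurable (sample_space X n \<Otimes>\<^sub>M X)"
      using f n unfolding statistic_def by blast
    moreover have "p j \<in> space X" using p(1) that by simp
    ultimately have "T j \<in> borel_measurable (sample_space X n)"
      unfolding T_def by (auto dest: measurable_Pair1)
    then show ?thesis by (simp only: measurable_cong_sets[OF sets_base_sample refl])
  qed
  have em: "(\<lambda>D. e s (T j D)) \<in> borel_measurable ?B" if "j \<in> {1..N}" for s j
  proof -
    have [measurable]: "T j \<in> borel_measurable ?B" using Tm[OF that] .
    note [measurable] = \<phi>
    show ?thesis unfolding e_def cell_risk_def by measurable
  qed
  have Gm[measurable]: "G \<sigma> \<in> borel_measurable ?B" for \<sigma> unfolding G_def by measurable
  have G0: "G \<sigma> D \<ge> 0" if "D \<in> space ?B" for \<sigma> D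
    unfolding G_def using dens_bounds[OF sample_component_space[OF that]] by (intro prod_nonneg) auto
  have IA: "I \<sigma> = (\<Sum>j=1..N. A j \<sigma>)" for \<sigma>
  proof -
    have "I \<sigma> = (\<integral>\<^sup>+ D. ennreal (G \<sigma> D) * ennreal (q * (\<Sum>j=1..N. e (cube_sign N \<sigma> j) (T j D))) \<partial>?B)"
    proof -
      have "PiM {1..n} (\<lambda>_. cube \<sigma>) = density ?B (\<lambda>D. ennreal (G \<sigma> D))"
        unfolding G_def by (rule PiM_cube)
      then show ?thesis unfolding I_def using em by (simp only:) (intro nn_integral_density; auto)
    qed
    also have "\<dots> = (\<integral>\<^sup>+ D. (\<Sum>j=1..N. ennreal (q * e (cube_sign N \<sigma> j) (T j D)) * ennreal (G \<sigma> D)) \<partial>?B)"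
    proof (rule nn_integral_cong)
      fix D
      have "ennreal (\<Sum>j=1..N. q * e (cube_sign N \<sigma> j) (T j D))
          = (\<Sum>j=1..N. ennreal (q * e (cube_sign N \<sigma> j) (T j D)))"
        using e0 q by (intro sum_ennreal[symmetric]) auto
      then show "ennreal (G \<sigma> D) * ennreal (q * (\<Sum>j=1..N. e (cube_sign N \<sigma> j) (T j D)))
          = (\<Sum>j=1..N. ennreal (q * e (cube_sign N \<sigma> j) (T j D)) * ennreal (G \<sigma> D))"
        by (simp add: sum_distrib_left mult.commute)
    qed
    also have "\<dots> = (\<Sum>j=1..N. A j \<sigma>)"
      unfolding A_def using em by (intro nn_integral_sum) auto
    finally show ?thesis .
  qed
  \<comment> \<open>One prediction \<open>T j D\<close> is judged under two laws that differ only in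
    the sign of cell \<open>j\<close>. Weighted by the smaller of the two densities, it pays
    \<delta> in total, whatever its value.\<close>
  have pair: "ennreal (q * \<delta> / 8) \<le> A j \<sigma> + A j (flip j \<sigma>)" if j: "j \<in> {1..N}" for j \<sigma>
  proof -
    let ?m = "\<lambda>D. min (G \<sigma> D) (G (flip j \<sigma>) D)" and ?s = "cube_sign N \<sigma> j"
    have im: "integrable ?B ?m" "1 / 8 \<le> (\<integral>D. ?m D \<partial>?B)"
      unfolding G_def by (rule integral_min_density_ge[OF j small])+
    have fs: "cube_sign N (flip j \<sigma>) j = - ?s" using cube_sign_flip[OF j] by simp
    have "ennreal (q * \<delta> / 8) \<le> ennreal (q * \<delta> * (\<integral>D. ?m D \<partial>?B))"
      using im(2) q \<delta> mult_left_mono[OF im(2), of "q * \<delta>"] by (intro ennreal_leI) simp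
    also have "\<dots> = ennreal (\<integral>D. q * \<delta> * ?m D \<partial>?B)" by simp
    also have "\<dots> = (\<integral>\<^sup>+ D. ennreal (q * \<delta> * ?m D) \<partial>?B)"
      using im(1) G0 q \<delta> by (intro nn_integral_eq_integral[symmetric] AE_I2 integrable_mult_right) auto
    also have "\<dots> \<le> (\<integral>\<^sup>+ D. ennreal (q * e ?s (T j D)) * ennreal (G \<sigma> D)
        + ennreal (q * e (- ?s) (T j D)) * ennreal (G (flip j \<sigma>) D) \<partial>?B)"
    proof (rule nn_integral_mono)
      fix D assume D: "D \<in> space ?B"
      have e1: "e ?s (T j D) \<ge> 0" "e (- ?s) (T j D) \<ge> 0"
        using e0[OF j, of \<sigma>] e0[OF j, of "flip j \<sigma>"] by (auto simp: fs)
      have "\<delta> \<le> e ?s (T j D) + e (- ?s) (T j D)"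
        using gap[of "T j D"] sgn[OF j, of \<sigma>] by (auto simp: e_def)
      then have "q * \<delta> * ?m D \<le> q * (e ?s (T j D) + e (- ?s) (T j D)) * ?m D"
        using q G0[OF D] by (intro mult_right_mono mult_left_mono) auto
      also have "\<dots> = q * e ?s (T j D) * ?m D + q * e (- ?s) (T j D) * ?m D" by (simp add: algebra_simps)
      also have "\<dots> \<le> q * e ?s (T j D) * G \<sigma> D + q * e (- ?s) (T j D) * G (flip j \<sigma>) D"
        using q e1 by (intro add_mono mult_left_mono) auto
      finally have "ennreal (q * \<delta> * ?m D) \<le> ennreal (q * e ?s (T j D) * G \<sigma> D + q * e (- ?s) (T j D) * G (flip j \<sigma>) D)"
        by (rule ennreal_leI)
      also have "\<dots> = ennreal (q * e ?s (T j D)) * ennreal (G \<sigma> D)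
        + ennreal (q * e (- ?s) (T j D)) * ennreal (G (flip j \<sigma>) D)"
        using q e1 G0[OF D] by (simp add: ennreal_mult)
      finally show "ennreal (q * \<delta> * ?m D) \<le> ennreal (q * e ?s (T j D)) * ennreal (G \<sigma> D)
        + ennreal (q * e (- ?s) (T j D)) * ennreal (G (flip j \<sigma>) D)" .
    qed
    also have "\<dots> = A j \<sigma> + A j (flip j \<sigma>)"
      unfolding A_def fs using em[OF j] by (intro nn_integral_add) auto
    finally show ?thesis .
  qed
  let ?S = "Pow {1..N}"
  have half: "of_nat (card ?S) * ennreal (q * \<delta> / 16) \<le> (\<Sum>\<sigma>\<in>?S. A j \<sigma>)" if j: "j \<in> {1..N}" for j
  proof -
    have "2 * (of_nat (card ?S) * ennreal (q * \<delta> / 16)) = of_nat (card ?S) * ennreal (q * \<delta> / 8)"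
    proof -
      have "2 * ennreal (q * \<delta> / 16) = ennreal (q * \<delta> / 8)"
        using q \<delta> ennreal_mult[of 2 "q * \<delta> / 16"] by (simp add: mult.commute)
      then show ?thesis by (metis mult.left_commute)
    qed
    also have "\<dots> = (\<Sum>\<sigma>\<in>?S. ennreal (q * \<delta> / 8))" by simp
    also have "\<dots> \<le> (\<Sum>\<sigma>\<in>?S. A j \<sigma> + A j (flip j \<sigma>))" using pair[OF j] by (intro sum_mono)
    \<comment> \<open>\<open>flip j\<close> permutes the vertices, so both summands have the same
      total.\<close>
    also have "\<dots> = 2 * (\<Sum>\<sigma>\<in>?S. A j \<sigma>)"
      using sum.reindex_bij_betw[OF bij_betw_flip[OF j], of "A j"] by (simp add: sum.distrib mult_2)
    finally show ?thesis by (subst (asm) ennreal_mult_le_mult_iff) auto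
  qed
  have "of_nat (card ?S) * ennreal (q * real N * \<delta> / 16) = (\<Sum>j=1..N. of_nat (card ?S) * ennreal (q * \<delta> / 16))"
    using q \<delta> by (simp add: ennreal_of_nat_eq_real_of_nat ennreal_mult[symmetric] mult_ac)
  also have "\<dots> \<le> (\<Sum>j=1..N. \<Sum>\<sigma>\<in>?S. A j \<sigma>)" using half by (intro sum_mono)
  also have "\<dots> = (\<Sum>\<sigma>\<in>?S. I \<sigma>)" unfolding IA by (rule sum.swap)
  finally have "\<exists>\<sigma>\<in>?S. ennreal (q * real N * \<delta> / 16) \<le> I \<sigma>" by (intro ex_ge_average_ennreal) auto
  then obtain \<sigma> where \<sigma>: "\<sigma> \<subseteq> {1..N}" "ennreal (q * real N * \<delta> / 16) \<le> I \<sigma>" by auto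
  have "(MIN g\<in>F. excess_risk \<phi> X (cube \<sigma>) g) + ereal (q * real N * \<delta> / 16) \<le> 0 + ereal (q * real N * \<delta> / 16)"
    using MIN[OF \<sigma>(1)] by (intro add_right_mono)
  also have "\<dots> \<le> enn2ereal (I \<sigma>)"
    using \<sigma>(2) q \<delta> by (simp add: less_eq_ennreal.rep_eq)
  also have "\<dots> \<le> expected_excess_risk \<phi> X (cube \<sigma>) f n" by (rule eer)
  finally show ?thesis using cube_pair_distributions by blast
qed

end

text \<open>The parameters \<open>q\<close>, \<epsilon>, \<rho> and \<delta> may depend on
  \<open>n\<close>, but \<open>N\<close> and the amplitude \<open>b\<close> may not, because they
  determine the dictionary. The sign patterns are padded with arbitrary further functions up to
  exactly \<open>M\<close> elements.\<close>

lemma lower_bound_hypercube: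
  fixes \<phi> :: "real \<Rightarrow> real" and X :: "'a measure" and q \<epsilon> \<rho> \<delta> :: "nat \<Rightarrow> real"
  assumes X: "infinite (sets X)" and M: "2 ^ N \<le> M" and b: "\<bar>b\<bar> \<le> 1"
    and \<phi>: "\<phi> \<in> borel_measurable borel"
    and q: "\<And>n. n \<ge> 1 \<Longrightarrow> 0 \<le> q n" "\<And>n. n \<ge> 1 \<Longrightarrow> real N * q n \<le> 1"
    and \<epsilon>: "\<And>n. n \<ge> 1 \<Longrightarrow> 0 \<le> \<epsilon> n" "\<And>n. n \<ge> 1 \<Longrightarrow> \<epsilon> n \<le> 1"
    and pos: "\<And>n s t. n \<ge> 1 \<Longrightarrow> s \<in> {-1, 1} \<Longrightarrow> \<rho> n \<le> cell_risk \<phi> (\<epsilon> n) s t"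
    and opt: "\<And>n s. n \<ge> 1 \<Longrightarrow> s \<in> {-1, 1} \<Longrightarrow> cell_risk \<phi> (\<epsilon> n) s (b * s) = \<rho> n"
    and gap: "\<And>n t. n \<ge> 1 \<Longrightarrow> 2 * \<rho> n + \<delta> n \<le> cell_risk \<phi> (\<epsilon> n) 1 t + cell_risk \<phi> (\<epsilon> n) (-1) t"
    and null: "\<And>n. n \<ge> 1 \<Longrightarrow> real N * q n = 1 \<or> (\<forall>t. \<phi> 0 \<le> cell_risk \<phi> (\<epsilon> n) 0 t)"
    and \<delta>: "\<And>n. n \<ge> 1 \<Longrightarrow> 0 \<le> \<delta> n"
    and small: "\<And>n. n \<ge> 1 \<Longrightarrow> real n * (q n * (\<epsilon> n)\<^sup>2) \<le> 1 / 2"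
  shows "lower_bound X M \<phi> (\<lambda>n. q n * real N * \<delta> n / 16)"
proof -
  obtain c where c: "c \<in> X \<rightarrow>\<^sub>M count_space (UNIV :: nat set)" "c ` space X = {..N}"
    using measurable_labelling[OF X] by blast
  define p where "p = (\<lambda>j. SOME x. x \<in> space X \<and> c x = j)"
  have p: "p j \<in> space X \<and> c (p j) = j" if "j \<le> N" for j
  proof -
    have "\<exists>x. x \<in> space X \<and> c x = j" using c(2) that by (metis atMost_iff imageE)
    then show ?thesis unfolding p_def by (rule someI_ex)
  qed
  have hc: "hypercube X c p N (q n) (\<epsilon> n)" if "n \<ge> 1" for n
    using c(1) p q[OF that] \<epsilon>[OF that] by unfold_locales auto
  define S where "S = (space X \<rightarrow>\<^sub>E {-1..1::real}) \<inter> borel_measurable X"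
  define F0 where "F0 = cube_function X c N b ` Pow {1..N}"
  have F0: "F0 \<subseteq> S" "finite F0" "card F0 \<le> M"
  proof -
    have "b * cube_sign N \<sigma> j \<in> {-1..1}" for \<sigma> j using b by (auto simp: cube_sign_def abs_le_iff)
    then show "F0 \<subseteq> S"
      using hypercube.cube_function_measurable[OF hc[OF order_refl]]
      unfolding F0_def S_def by (auto simp: cube_function_def)
    show "finite F0" by (simp add: F0_def)
    have "card F0 \<le> card (Pow {1..N})" unfolding F0_def by (rule card_image_le) simp
    then show "card F0 \<le> M" using M by (simp add: card_Pow)
  qed
  \<comment> \<open>The constant functions already provide enough material for the padding.\<close>
  have "infinite S"
  proof -
    have ne: "space X \<noteq> {}" using p[of 0] by auto
    have "inj_on (\<lambda>a. restrict (\<lambda>_. a) (space X)) {0..1::real}"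
      using ne by (auto simp: inj_on_def fun_eq_iff restrict_def)
    moreover have "(\<lambda>a. restrict (\<lambda>_. a) (space X)) ` {0..1::real} \<subseteq> S"
      unfolding S_def by (auto cong: measurable_cong)
    moreover have "infinite {0..1::real}" by (simp add: infinite_Icc)
    ultimately show ?thesis using finite_imageD finite_subset by blast
  qed
  then have "infinite (S - F0)" using F0(2) by simp
  then obtain E where E: "finite E" "card E = M - card F0" "E \<subseteq> S - F0"
    using infinite_arbitrarily_large by blast
  define F where "F = F0 \<union> E"
  have "card F = M" unfolding F_def using E F0 by (subst card_Un_disjoint) auto
  then have F: "F \<in> dictionaries X M" using E F0 unfolding F_def dictionaries_def S_def by auto
  show ?thesis unfolding lower_bound_def
  proof (intro bexI[OF _ F] allI impI)
    fix f and n :: nat assume f: "statistic X f" and n: "n \<ge> 1"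
    show "\<exists>\<pi>\<in>pair_distributions X. (MIN g\<in>F. excess_risk \<phi> X \<pi> g) + ereal (q n * real N * \<delta> n / 16)
        \<le> expected_excess_risk \<phi> X \<pi> f n"
    proof (rule hypercube.minimax_lower_bound[OF hc[OF n] \<phi> pos[OF n] opt[OF n] gap[OF n] null[OF n]
          \<delta>[OF n] small[OF n] f n])
      show "finite F" using E F0 by (simp add: F_def)
      show "cube_function X c N b \<sigma> \<in> F" if "\<sigma> \<subseteq> {1..N}" for \<sigma> using that by (auto simp: F_def F0_def)
    qed
  qed
qed

section \<open>The losses\<close>

lemma loss_measurable: "loss h \<in> borel_measurable borel"
  unfolding loss_def by (cases "h \<le> 1") simp_all

section \<open>Lower bounds for the losses\<close>

text \<open>N is the integer part of the binary logarithm of M; the factor 2 comes from N + 1 \<le>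
  2 N, with ln 2 bounded by 1.\<close>

lemma log_dimension:
  assumes "M \<ge> (2::nat)"
  obtains N :: nat where "N \<ge> 1" "2 ^ N \<le> M" "ln M \<le> 2 * N"
proof -
  obtain N where N: "2 ^ N \<le> M" "M < 2 ^ (N + 1)" using ex_power_ivl1[of 2 M] assms by auto
  have N1: "N \<ge> 1" using N assms by (cases N) auto
  have "real M \<le> 2 ^ (N + 1)" using N(2) by (metis less_imp_le of_nat_le_iff of_nat_numeral of_nat_power)
  then have "ln M \<le> ln (2 ^ (N + 1) :: real)" using assms by (subst ln_le_cancel_iff) auto
  also have "\<dots> = real (N + 1) * ln 2" by (rule ln_realpow)
  also have "\<dots> \<le> real (N + 1) * 1" using ln_2_less_1 by (intro mult_left_mono) auto
  also have "\<dots> \<le> 2 * N" using N1 by simp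
  finally show ?thesis using that N1 N(1) by blast
qed

text \<open>The cells have mass 1/N, so cell 0 is empty of mass. Predicting the right sign has loss
  0 and the wrong one 1 + h, whence \<rho>. The gap is at least \<epsilon> (1 + h), of which
  \<epsilon> is kept to make the constant independent of h.\<close>

lemma loss_lower_bound_linear:
  assumes h: "0 \<le> h" "h \<le> 1" and X: "infinite (sets X)" and M: "M \<ge> 2"
  shows "lower_bound X M (loss h) (\<lambda>n. 1 / 32 * min 1 (sqrt (ln M / real n)))"
proof -
  obtain N :: nat where N: "N \<ge> 1" "2 ^ N \<le> M" "ln M \<le> 2 * N" using log_dimension[OF M] .
  \<comment> \<open>The largest value up to 1 allowed by \<open>small\<close> when \<open>q\<close>
    is 1/N.\<close>
  define \<epsilon> where "\<epsilon> = (\<lambda>n. min 1 (sqrt (real N / (2 * real n))))"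
  have \<epsilon>: "0 \<le> \<epsilon> n" "\<epsilon> n \<le> 1" for n by (simp_all add: \<epsilon>_def)
  have l0: "loss h t \<ge> 0" for t using h by (simp add: loss_def)
  have sum2: "1 + h \<le> loss h t + loss h (- t)" for t
  proof -
    have "h * 2 \<le> h * (max 0 (1 - t) + max 0 (1 + t))" using h by (intro mult_left_mono) auto
    moreover have "(1 - h) * 1 \<le> (1 - h) * (of_bool (t \<le> 0) + of_bool (0 \<le> t))"
      using h by (intro mult_left_mono) auto
    ultimately show ?thesis using h by (simp add: loss_def distrib_left)
  qed
  have "lower_bound X M (loss h) (\<lambda>n. 1 / real N * real N * \<epsilon> n / 16)"
  proof (rule lower_bound_hypercube[where b = 1 and \<epsilon> = \<epsilon> and \<rho> = "\<lambda>n. (1 - \<epsilon> n) * (1 + h) / 2", OF X N(2)])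
    fix n :: nat assume n: "n \<ge> 1"
    show "(1 - \<epsilon> n) * (1 + h) / 2 \<le> cell_risk (loss h) (\<epsilon> n) s t" if s: "s \<in> {-1, 1}" for s t
    proof -
      have "(1 - \<epsilon> n) / 2 * (1 + h) \<le> (1 - \<epsilon> n) / 2 * (loss h t + loss h (- t))"
        using sum2 \<epsilon> by (intro mult_left_mono) auto
      moreover have "0 \<le> \<epsilon> n * loss h t" "0 \<le> \<epsilon> n * loss h (- t)" using \<epsilon> l0 by auto
      ultimately show ?thesis using s by (auto simp: cell_risk_def field_simps)
    qed
    show "cell_risk (loss h) (\<epsilon> n) s (1 * s) = (1 - \<epsilon> n) * (1 + h) / 2" if s: "s \<in> {-1, 1}" for s
      using s h by (auto simp: cell_risk_def loss_def field_simps)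
    show "2 * ((1 - \<epsilon> n) * (1 + h) / 2) + \<epsilon> n
        \<le> cell_risk (loss h) (\<epsilon> n) 1 t + cell_risk (loss h) (\<epsilon> n) (- 1) t" for t
    proof -
      have "cell_risk (loss h) (\<epsilon> n) 1 t + cell_risk (loss h) (\<epsilon> n) (- 1) t = loss h t + loss h (- t)"
        by (simp add: cell_risk_def field_simps)
      moreover have "0 \<le> \<epsilon> n * h" using \<epsilon> h by simp
      ultimately show ?thesis using sum2[of t] by (simp add: field_simps)
    qed
    show "real n * (1 / real N * (\<epsilon> n)\<^sup>2) \<le> 1 / 2"
    proof -
      have "(\<epsilon> n)\<^sup>2 \<le> (sqrt (real N / (2 * real n)))\<^sup>2" unfolding \<epsilon>_def by (intro power_mono) auto
      also have "\<dots> = real N / (2 * real n)" by simp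
      finally have "real n * (1 / real N * (\<epsilon> n)\<^sup>2) \<le> real n * (1 / real N * (real N / (2 * real n)))"
        by (intro mult_left_mono) auto
      also have "\<dots> = 1 / 2" using n N(1) by simp
      finally show ?thesis .
    qed
  qed (use N(1) \<epsilon> loss_measurable in auto)
  then show ?thesis
  proof (rule lower_bound_mono)
    fix n :: nat assume n: "n \<ge> 1"
    have "min 1 (sqrt (ln M / real n)) \<le> 2 * \<epsilon> n"
    proof -
      have "sqrt (ln M / real n) \<le> sqrt (4 * (real N / (2 * real n)))"
        using N(3) n by (intro real_sqrt_le_mono) (simp add: field_simps)
      also have "\<dots> = 2 * sqrt (real N / (2 * real n))" by (simp only: real_sqrt_mult real_sqrt_four)
      finally have le: "sqrt (ln M / real n) \<le> 2 * sqrt (real N / (2 * real n))" .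
      have "min 1 u \<le> 2 * min 1 v" if "u \<le> 2 * v" "0 \<le> v" for u v :: real
        using that by (simp add: min_def)
      then show ?thesis unfolding \<epsilon>_def using le by simp
    qed
    then show "1 / 32 * min 1 (sqrt (ln M / real n)) \<le> 1 / real N * real N * \<epsilon> n / 16" using N(1) by simp
  qed
qed

text \<open>The cell risk is a parabola with vertex at \<open>b * s\<close> and minimum \<rho>. The
  value 0 is the best compromise between the two signs, with total excess \<delta>.\<close>

lemma loss_lower_bound_quadratic:
  assumes h: "h > 1" and X: "infinite (sets X)" and M: "M \<ge> 2"
  shows "lower_bound X M (loss h) (\<lambda>n. (min 1 (2 * (h - 1)))\<^sup>2 / (128 * (h - 1)) * min 1 (ln M / real n))"
proof -
  obtain N :: nat where N: "N \<ge> 1" "2 ^ N \<le> M" "ln M \<le> 2 * N" using log_dimension[OF M] .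
  define a where "a = h - 1"
  \<comment> \<open>The bound 2 a keeps the amplitude \<open>b\<close> at most 1, so that the
    minimizers belong to a dictionary.\<close>
  define \<epsilon> where "\<epsilon> = min 1 (2 * a)"
  define b where "b = \<epsilon> / (2 * a)"
  define \<rho> where "\<rho> = 1 - \<epsilon>\<^sup>2 / (4 * a)"
  define \<delta> where "\<delta> = \<epsilon>\<^sup>2 / (2 * a)"
  \<comment> \<open>The maximum bounds both n q and N q by 1/2.\<close>
  define q where "q = (\<lambda>n. 1 / (2 * max (real n) (real N)))"
  have a: "a > 0" using h by (simp add: a_def)
  have \<epsilon>: "0 < \<epsilon>" "\<epsilon> \<le> 1" "\<epsilon> \<le> 2 * a" using a by (simp_all add: \<epsilon>_def)
  have e2: "\<epsilon>\<^sup>2 \<le> 1" using \<epsilon> by (simp add: power_le_one)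
  have cr: "cell_risk (loss h) \<epsilon> s t = a * t\<^sup>2 - \<epsilon> * s * t + 1" for s t
    using h by (simp add: cell_risk_def loss_def a_def field_simps)
  have sq: "a * t\<^sup>2 - \<epsilon> * s * t + 1 = a * (t - b * s)\<^sup>2 + \<rho>" if "s \<in> {-1, 1}" for s t
    using that a by (auto simp: b_def \<rho>_def power2_eq_square field_simps)
  have "lower_bound X M (loss h) (\<lambda>n. q n * real N * \<delta> / 16)"
  proof (rule lower_bound_hypercube[where b = b and \<epsilon> = "\<lambda>_. \<epsilon>" and \<rho> = "\<lambda>_. \<rho>", OF X N(2)])
    show "\<bar>b\<bar> \<le> 1" using a \<epsilon> by (simp add: b_def field_simps)
    fix n :: nat assume n: "n \<ge> 1"
    show "0 \<le> q n" by (simp add: q_def)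
    have mx: "max (real n) (real N) > 0" using n by simp
    show "real N * q n \<le> 1" using mx by (simp add: q_def divide_le_eq)
    show "\<rho> \<le> cell_risk (loss h) \<epsilon> s t" "cell_risk (loss h) \<epsilon> s (b * s) = \<rho>" if "s \<in> {-1, 1}" for s t
      unfolding cr sq[OF that] using a by simp_all
    show "2 * \<rho> + \<delta> \<le> cell_risk (loss h) \<epsilon> 1 t + cell_risk (loss h) \<epsilon> (- 1) t" for t
      unfolding cr using a by (simp add: \<rho>_def \<delta>_def field_simps)
    show "real N * q n = 1 \<or> (\<forall>t. loss h 0 \<le> cell_risk (loss h) \<epsilon> 0 t)"
      unfolding cr using a h by (simp add: loss_def)
    show "0 \<le> \<delta>" using a by (simp add: \<delta>_def)
    have "real n * (q n * \<epsilon>\<^sup>2) \<le> real n * (q n * 1)"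
      using e2 by (intro mult_left_mono) (auto simp: q_def)
    also have "\<dots> \<le> 1 / 2" using mx by (simp add: q_def divide_le_eq)
    finally show "real n * (q n * \<epsilon>\<^sup>2) \<le> 1 / 2" .
  qed (use \<epsilon> loss_measurable in auto)
  then show ?thesis
  proof (rule lower_bound_mono)
    fix n :: nat assume n: "n \<ge> 1"
    have d: "\<delta> / 64 = (min 1 (2 * (h - 1)))\<^sup>2 / (128 * (h - 1))" by (simp add: \<delta>_def \<epsilon>_def a_def)
    \<comment> \<open>For N \<le> n this is ln M \<le> 2 N; for N > n the informative mass is 1/2
      and the truncation of the rate at 1 applies.\<close>
    have "min 1 (ln M / real n) / 4 \<le> q n * real N"
    proof (cases "real N \<le> real n")
      case True
      have "ln M / real n \<le> 2 * real N / real n" using N(3) by (intro divide_right_mono) auto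
      then have "min 1 (ln M / real n) \<le> 2 * real N / real n" by (rule min.coboundedI2)
      also have "\<dots> = 4 * (q n * real N)" using True by (simp add: q_def max_def)
      finally show ?thesis by simp
    next
      case False
      then have "q n * real N = 1 / 2" using N(1) by (simp add: q_def max_def)
      then show ?thesis by simp
    qed
    then have "min 1 (ln M / real n) / 4 * (\<delta> / 16) \<le> q n * real N * (\<delta> / 16)"
      using a by (intro mult_right_mono) (auto simp: \<delta>_def)
    then show "(min 1 (2 * (h - 1)))\<^sup>2 / (128 * (h - 1)) * min 1 (ln M / real n) \<le> q n * real N * \<delta> / 16"
      unfolding d[symmetric] by (simp add: mult_ac)
  qed
qed

section \<open>Upper bounds for the losses and the final constants\<close>

lemma upper_bound_by_mono:
  assumes "upper_bound_by X M \<phi> proc r" and le: "\<And>n. n \<ge> 1 \<Longrightarrow> r n \<le> r' n"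
  shows "upper_bound_by X M \<phi> proc r'"
proof -
  have "b \<le> a + ereal (r' n)" if "b \<le> a + ereal (r n)" "n \<ge> 1" for a b n
    using that(1) by (rule order_trans) (simp add: add_left_mono le that(2))
  then show ?thesis using assms(1) unfolding upper_bound_by_def by meson
qed

text \<open>The constant 8 is that of CAEW for the hinge loss: for h = 1 a single
  \<open>C\<^sub>1\<close> has to serve all three procedures.\<close>

lemma loss_upper_bound_ERM:
  assumes h: "0 \<le> h" "h \<le> 1" and M: "M \<ge> 2"
  shows "upper_bound_by X M (loss h) (ERM (loss h)) (\<lambda>n. 8 * sqrt (ln M / real n))"
proof (rule upper_bound_by_mono)
  show "upper_bound_by X M (loss h) (ERM (loss h)) (\<lambda>n. 2 * sqrt (ln M / (2 * real n)))"
  proof (rule upper_bound_ERM[OF loss_measurable _ _ _ M])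
    fix t :: real
    show "loss h t \<ge> 0" using h by (simp add: loss_def)
    assume t: "t \<in> {-1..1}"
    have "h * max 0 (1 - t) \<le> h * 2" using t h by (intro mult_left_mono) auto
    moreover have "(1 - h) * of_bool (t \<le> 0) \<le> (1 - h) * 1" using h by (intro mult_left_mono) auto
    ultimately have "loss h t \<le> 2" using h by (simp add: loss_def)
    then show "loss h t \<in> {0..2}" using \<open>loss h t \<ge> 0\<close> by simp
  qed simp
  fix n :: nat assume "n \<ge> 1"
  then have "sqrt (ln M / (2 * real n)) \<le> sqrt (ln M / real n)"
    using M by (intro real_sqrt_le_mono divide_left_mono) auto
  moreover have "0 \<le> sqrt (ln M / real n)" using M by simp
  ultimately show "2 * sqrt (ln M / (2 * real n)) \<le> 8 * sqrt (ln M / real n)" by linarith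
qed

lemma loss_upper_bound_hinge:
  assumes M: "M \<ge> 2"
  shows "upper_bound_by X M (loss 1) (AEW (loss 1)) (\<lambda>n. 8 * sqrt (ln M / real n))"
    and "upper_bound_by X M (loss 1) (CAEW (loss 1) 1) (\<lambda>n. 8 * sqrt (ln M / real n))"
proof -
  have conv: "convex_on {-1..1} (loss 1)"
  proof (rule convex_onI)
    fix t x y :: real assume *: "0 < t" "t < 1" "x \<in> {-1..1}" "y \<in> {-1..1}"
    then have "(1 - t) * x + t * y \<le> 1" by (intro convex_bound_le) auto
    then show "loss 1 ((1 - t) *\<^sub>R x + t *\<^sub>R y) \<le> (1 - t) * loss 1 x + t * loss 1 y"
      using * by (simp add: loss_def algebra_simps)
  qed simp
  have B: "loss 1 t \<in> {0..2}" if "t \<in> {-1..1}" for t using that by (auto simp: loss_def)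
  have pos: "loss 1 t \<ge> 0" for t by (simp add: loss_def)
  show "upper_bound_by X M (loss 1) (CAEW (loss 1) 1) (\<lambda>n. 8 * sqrt (ln M / real n))"
    by (rule upper_bound_CAEW_hinge[OF loss_measurable B conv pos M])
  have "upper_bound_by X M (loss 1) (AEW (loss 1)) (\<lambda>n. 4 * sqrt (ln M / real n))"
    by (rule upper_bound_AEW[OF loss_measurable B conv pos M])
  then show "upper_bound_by X M (loss 1) (AEW (loss 1)) (\<lambda>n. 8 * sqrt (ln M / real n))"
    using M by (rule_tac upper_bound_by_mono) auto
qed

text \<open>On [-1, 1] the absolute value of the loss is at most its value h + 1 at -1; on the line,
  completing the square gives a lower bound.\<close>

lemma loss_upper_bound_quadratic:
  assumes h: "h > 1" and M: "M \<ge> 2"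
  defines "\<beta> \<equiv> (2 * h - 1)\<^sup>2 / (2 * (h - 1))"
  shows "upper_bound_by X M (loss h) (CAEW (loss h) \<beta>)
    (\<lambda>n. (\<beta> + 2 * (h + 1) / ln 2) * (ln M / real n))"
proof (rule upper_bound_by_mono)
  define a where "a = h - 1"
  have a: "a > 0" using h by (simp add: a_def)
  have \<beta>a: "\<beta> = (2 * a + 1)\<^sup>2 / (2 * a)" by (simp add: \<beta>_def a_def algebra_simps)
  have l: "loss h = (\<lambda>t. a * t\<^sup>2 - t + 1)" using h by (auto simp: loss_def a_def)
  show "upper_bound_by X M (loss h) (CAEW (loss h) \<beta>) (\<lambda>n. (\<beta> * ln M + 2 * (h + 1)) / real n)"
  proof (rule upper_bound_CAEW_exp_concave[OF loss_measurable _ _ _ _ _ M, where K = "1 / (4 * a)"])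
    show "\<bar>loss h t\<bar> \<le> h + 1" if "t \<in> {-1..1}" for t
    proof -
      have "t\<^sup>2 \<le> 1" using that by (simp add: abs_square_le_1 abs_le_iff)
      then have "a * t\<^sup>2 \<le> a * 1" "0 \<le> a * t\<^sup>2" using a by (auto intro: mult_left_mono)
      then show ?thesis using that by (auto simp: l a_def abs_le_iff)
    qed
    show "convex_on {-1..1} (loss h)" unfolding l
      by (rule f''_ge0_imp_convex[where f' = "\<lambda>t. 2 * a * t - 1" and f'' = "\<lambda>_. 2 * a"])
         (use a in \<open>auto intro!: derivative_eq_intros\<close>)
    show "concave_on {-1..1} (\<lambda>t. exp (- (inverse \<beta> * loss h t)))"
      unfolding l \<beta>a by (rule quadratic_loss_exp_concave[OF a])
    show "\<beta> > 0" unfolding \<beta>a using a by (intro divide_pos_pos) auto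
    show "- (1 / (4 * a)) \<le> loss h t" for t
    proof -
      have "loss h t = a * (t - 1 / (2 * a))\<^sup>2 - 1 / (4 * a) + 1"
        using a by (simp add: l power2_eq_square field_simps)
      moreover have "0 \<le> a * (t - 1 / (2 * a))\<^sup>2" using a by simp
      ultimately show ?thesis by linarith
    qed
  qed
  fix n :: nat assume n: "n \<ge> 1"
  \<comment> \<open>Since \<open>M \<ge> 2\<close>, the additive constant is a multiple of ln
    M.\<close>
  have "ln 2 \<le> ln (real M)" using M by simp
  then have "2 * (h + 1) * ln 2 \<le> 2 * (h + 1) * ln M" using h by (intro mult_left_mono) auto
  then have "2 * (h + 1) \<le> 2 * (h + 1) / ln 2 * ln M" by (simp add: field_simps)
  then have "(\<beta> * ln M + 2 * (h + 1)) / real n \<le> (\<beta> * ln M + 2 * (h + 1) / ln 2 * ln M) / real n"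
    by (intro divide_right_mono) auto
  also have "\<dots> = (\<beta> + 2 * (h + 1) / ln 2) * (ln M / real n)"
    by (simp only: distrib_right[of \<beta>, symmetric] times_divide_eq_right)
  finally show "(\<beta> * ln M + 2 * (h + 1)) / real n \<le> (\<beta> + 2 * (h + 1) / ln 2) * (ln M / real n)" .
qed

theorem theorem2:
  fixes h :: real
  assumes "0 \<le> h"
  shows "\<exists>C\<^sub>1>0. \<exists>C\<^sub>2>0. \<forall>(X :: 'a measure) (M :: nat).
    M \<ge> 2 \<and> infinite (space X) \<and> infinite (sets X) \<longrightarrow>
      (h < 1 \<longrightarrow>
         optimal_rate_achieved_by C\<^sub>1 C\<^sub>2 X M (loss h) (\<lambda>n M. sqrt (ln (real M) / real n)) (ERM (loss h))) \<and>
      (h = 1 \<longrightarrow>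
         optimal_rate_achieved_by C\<^sub>1 C\<^sub>2 X M (loss 1) (\<lambda>n M. sqrt (ln (real M) / real n)) (ERM (loss 1)) \<and>
         optimal_rate_achieved_by C\<^sub>1 C\<^sub>2 X M (loss 1) (\<lambda>n M. sqrt (ln (real M) / real n)) (AEW (loss 1)) \<and>
         optimal_rate_achieved_by C\<^sub>1 C\<^sub>2 X M (loss 1) (\<lambda>n M. sqrt (ln (real M) / real n)) (CAEW (loss 1) 1)) \<and>
      (h > 1 \<longrightarrow>
         optimal_rate_achieved_by C\<^sub>1 C\<^sub>2 X M (loss h) (\<lambda>n M. ln (real M) / real n)
           (CAEW (loss h) ((2 * h - 1)\<^sup>2 / (2 * (h - 1)))))"
proof (cases "h \<le> 1")
  \<comment> \<open>The constants are chosen before \<open>X\<close> and \<open>M\<close> but may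
    depend on \<open>h\<close>, so the regime is fixed before the witnesses are given.\<close>
  case True
  show ?thesis
  proof (rule exI[of _ 8], intro exI[of _ "1 / 32"] conjI allI impI; (elim conjE)?)
    fix X :: "'a measure" and M :: nat
    assume M: "M \<ge> 2" and X: "infinite (sets X)"
    note low = loss_lower_bound_linear[OF assms True X M]
    show "optimal_rate_achieved_by 8 (1 / 32) X M (loss h) (\<lambda>n M. sqrt (ln (real M) / real n)) (ERM (loss h))"
      using low loss_upper_bound_ERM[OF assms True M] by (simp add: optimal_rate_achieved_by_def)
    assume h1: "h = 1"
    show "optimal_rate_achieved_by 8 (1 / 32) X M (loss 1) (\<lambda>n M. sqrt (ln (real M) / real n)) (ERM (loss 1))"
      "optimal_rate_achieved_by 8 (1 / 32) X M (loss 1) (\<lambda>n M. sqrt (ln (real M) / real n)) (AEW (loss 1))"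
      "optimal_rate_achieved_by 8 (1 / 32) X M (loss 1) (\<lambda>n M. sqrt (ln (real M) / real n)) (CAEW (loss 1) 1)"
      using low[unfolded h1] loss_upper_bound_ERM[OF assms True M, unfolded h1] loss_upper_bound_hinge[OF M]
      by (simp_all add: optimal_rate_achieved_by_def)
  qed (use True in auto)
next
  case False
  then have h: "h > 1" by simp
  let ?\<beta> = "(2 * h - 1)\<^sup>2 / (2 * (h - 1))"
  let ?C = "?\<beta> + 2 * (h + 1) / ln 2" and ?c = "(min 1 (2 * (h - 1)))\<^sup>2 / (128 * (h - 1))"
  have C: "?C > 0" "?c > 0"
    using h by (auto intro!: add_pos_pos divide_pos_pos zero_less_power)
  have opt: "optimal_rate_achieved_by ?C ?c X M (loss h) (\<lambda>n M. ln (real M) / real n) (CAEW (loss h) ?\<beta>)"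
    if "M \<ge> 2" "infinite (sets X)" for X :: "'a measure" and M :: nat
    using loss_lower_bound_quadratic[OF h that(2,1)] loss_upper_bound_quadratic[OF h that(1)]
    by (simp add: optimal_rate_achieved_by_def)
  show ?thesis
    by (rule exI[of _ ?C], intro exI[of _ ?c] conjI allI impI; (elim conjE)?) (use opt h C in auto)
qed

end
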